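(* Let $\mathcal{R}$ be a finite-unification set ($\mathbf{fus}$) of single-headed existential rules over a signature whose predicates all have arity at most $2$. Then $\mathcal{R}$ is a finite-cliquewidth set ($\mathbf{fcs}$).
   Context: Instances: countable sets of atoms with constants or nulls as terms; databases: finite instances with only constants; homomorphisms are identity on constants and preserve atoms. An existential rule is $\forall\vec x\forall\vec y(B(\vec x,\vec y)\to\exists\vec z H(\vec y,\vec z))$ with $B,H$ conjunctions of atoms; it is single-headed if $H$ is a single atom. A model of $(F,\mathcal{R})$ is an instance containing $F$ satisfying all rules; a universal model is a model with a homomorphism into every model. $\mathcal{R}$ is $\mathbf{fus}$ if for every conjunctive query $q(\vec x)$ (existentially quantified conjunction of atoms with free variables $\vec x$) there is a finite set $\mathcal{Q}$ of conjunctive queries with free variables $\vec x$ such that for every finite instance $F$ and tuple $\vec t$ of its terms, $(F,\mathcal{R})\models q(\vec t)$ iff $F\models q'(\vec t)$ for some $q'\in\mathcal{Q}$. Cliquewidth: for a finite color set $\mathbb{L}$ and finite constant set $\mathrm{Cnst}$, a well-decorated tree labels each node $s\in\{0,1\}^*$ of the infinite binary tree by exactly one of $c_k$ ($c\in\mathrm{Cnst}\cup\{*\}$, $k\in\mathbb{L}$), $\mathrm{Add}_{R,\vec k}$, $\mathrm{Recolor}_{k\to k'}$, $\oplus$, $\mathrm{Void}$, with: each constant decorated at most once; $\mathrm{Add}$/$\mathrm{Recolor}$ nodes have non-$\mathrm{Void}$ left child and $\mathrm{Void}$ right child; $\oplus$ nodes have two non-$\mathrm{Void}$ children; $\mathrm{Void}$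 and $c_k$ nodes have $\mathrm{Void}$ children. Node $s$ represents the elements introduced in its subtree ($*_k$ at a node introduces that node as a null, $c_k$ introduces constant $c$), colored with the introduction color as modified by $\mathrm{Recolor}_{k\to k'}$ nodes (recolor all $k$-colored elements to $k'$) on the path up to $s$; $\oplus$ is disjoint union; an $\mathrm{Add}_{R,\vec k}$ node adds $R(\vec e)$ for all tuples $\vec e$ of its elements with colors $\vec k$. The represented instance is the set of all added atoms (plus $\top$-atoms for elements). $\mathrm{cw}(I)$ is the least $|\mathbb{L}|$ such that some coloring of $I$ is isomorphic to a colored instance represented by a well-decorated tree ($\infty$ if none). $\mathcal{R}$ is $\mathbf{fcs}$ if for every database $\mathcal{D}$ there is a universal model of $(\mathcal{D},\mathcal{R})$ of finite cliquewidth. *)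

theory Defs
  imports Main "HOL-Library.Extended_Nat"
begin

text \<open>
  A signature is a finite set of predicates that contains a distinguished unary predicate
  (usually written \<open>\<top>\<close>), which holds of every term of every instance.
\<close>

record 'p sig =
  preds :: "'p set"
  arity :: "'p \<Rightarrow> nat"
  verum :: 'p

definition is_sig :: "'p sig \<Rightarrow> bool" where
  "is_sig S \<longleftrightarrow> finite (preds S) \<and> verum S \<in> preds S \<and> arity S (verum S) = 1"

definition at_most_binary :: "'p sig \<Rightarrow> bool" where
  "at_most_binary S \<longleftrightarrow> (\<forall>p\<in>preds S. arity S p \<le> 2)"

text \<open>
  The terms of ordinary instances have type \<open>nat trm\<close>; the type of nulls is a parameter so that
  instances represented by trees can use tree nodes as nulls.  The atoms of rules and queries have
  variables, of type \<open>nat\<close>, as their arguments.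
\<close>

datatype 'n trm = Const nat | Null 'n

datatype ('p, 't) atom = Atom (pred: 'p) (args: "'t list")

abbreviation apply_atom :: "('s \<Rightarrow> 't) \<Rightarrow> ('p, 's) atom \<Rightarrow> ('p, 't) atom" where
  "apply_atom h \<equiv> map_atom id h"

definition is_atom :: "'p sig \<Rightarrow> ('p, 't) atom \<Rightarrow> bool" where
  "is_atom S a \<longleftrightarrow> pred a \<in> preds S \<and> length (args a) = arity S (pred a)"

definition adom :: "('p, 't) atom set \<Rightarrow> 't set" where
  "adom X = (\<Union>a\<in>X. set (args a))"

type_synonym ('p, 'n) inst = "('p, 'n trm) atom set"

text \<open>
  Instances over \<open>nat trm\<close> are automatically countable, since the signature is finite.
\<close>

definition is_instance :: "'p sig \<Rightarrow> ('p, 'n) inst \<Rightarrow> bool" where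
  "is_instance S I \<longleftrightarrow>
     (\<forall>a\<in>I. is_atom S a) \<and> (\<forall>t\<in>adom I. Atom (verum S) [t] \<in> I)"

definition is_database :: "'p sig \<Rightarrow> ('p, nat) inst \<Rightarrow> bool" where
  "is_database S D \<longleftrightarrow> is_instance S D \<and> finite D \<and> adom D \<subseteq> range Const"

definition hom :: "('p, 'n) inst \<Rightarrow> ('p, 'm) inst \<Rightarrow> ('n trm \<Rightarrow> 'm trm) \<Rightarrow> bool" where
  "hom I J h \<longleftrightarrow>
     (\<forall>c. Const c \<in> adom I \<longrightarrow> h (Const c) = Const c) \<and> apply_atom h ` I \<subseteq> J"

definition iso :: "('p, 'n) inst \<Rightarrow> ('p, 'm) inst \<Rightarrow> ('n trm \<Rightarrow> 'm trm) \<Rightarrow> bool" where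
  "iso I J h \<longleftrightarrow>
     bij_betw h (adom I) (adom J) \<and> hom I J h \<and> hom J I (inv_into (adom I) h)"

text \<open>
  A rule is given by its body and head.  The variables of the head that do not occur in the body
  are the existentially quantified ones.
\<close>

datatype 'p rule = Rule (body: "('p, nat) atom set") (head: "('p, nat) atom set")

definition is_rule :: "'p sig \<Rightarrow> 'p rule \<Rightarrow> bool" where
  "is_rule S r \<longleftrightarrow>
     finite (body r) \<and> finite (head r) \<and> (\<forall>a\<in>body r \<union> head r. is_atom S a)"

definition single_headed :: "'p rule \<Rightarrow> bool" where
  "single_headed r \<longleftrightarrow> (\<exists>a. head r = {a})"

definition sat_rule :: "('p, nat) inst \<Rightarrow> 'p rule \<Rightarrow> bool" where
  "sat_rule I r \<longleftrightarrow>
     (\<forall>h. apply_atom h ` body r \<subseteq> I \<longrightarrow>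
        (\<exists>g. (\<forall>v\<in>adom (body r). g v = h v) \<and> apply_atom g ` head r \<subseteq> I))"

definition is_model ::
  "'p sig \<Rightarrow> ('p, nat) inst \<Rightarrow> 'p rule set \<Rightarrow> ('p, nat) inst \<Rightarrow> bool" where
  "is_model S F R M \<longleftrightarrow> is_instance S M \<and> F \<subseteq> M \<and> (\<forall>r\<in>R. sat_rule M r)"

definition universal_model ::
  "'p sig \<Rightarrow> ('p, nat) inst \<Rightarrow> 'p rule set \<Rightarrow> ('p, nat) inst \<Rightarrow> bool" where
  "universal_model S F R U \<longleftrightarrow>
     is_model S F R U \<and> (\<forall>M. is_model S F R M \<longrightarrow> (\<exists>h. hom U M h))"

text \<open>
  A conjunctive query is given by its tuple of free variables and its conjunction of atoms; all
  other variables are existentially quantified.  A variable may be repeated in the tuple, which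
  stands for an equality between free variables.  Without this no rewriting of \<open>q(x,y) = E(x,y)\<close>
  under \<open>A(x) \<longrightarrow> E(x,x)\<close> would exist.
\<close>

datatype 'p cq = CQ (free: "nat list") (atoms: "('p, nat) atom set")

definition is_cq :: "'p sig \<Rightarrow> 'p cq \<Rightarrow> bool" where
  "is_cq S q \<longleftrightarrow>
     finite (atoms q) \<and> (\<forall>a\<in>atoms q. is_atom S a) \<and> set (free q) \<subseteq> adom (atoms q)"

definition sat_cq :: "('p, nat) inst \<Rightarrow> 'p cq \<Rightarrow> nat trm list \<Rightarrow> bool" where
  "sat_cq I q ts \<longleftrightarrow> (\<exists>h. map h (free q) = ts \<and> apply_atom h ` atoms q \<subseteq> I)"

definition entails ::
  "'p sig \<Rightarrow> ('p, nat) inst \<Rightarrow> 'p rule set \<Rightarrow> 'p cq \<Rightarrow> nat trm list \<Rightarrow> bool" where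
  "entails S F R q ts \<longleftrightarrow> (\<forall>M. is_model S F R M \<longrightarrow> sat_cq M q ts)"

definition is_rewriting :: "'p sig \<Rightarrow> 'p rule set \<Rightarrow> 'p cq \<Rightarrow> 'p cq set \<Rightarrow> bool" where
  "is_rewriting S R q Q \<longleftrightarrow>
     finite Q \<and> (\<forall>q'\<in>Q. is_cq S q' \<and> length (free q') = length (free q)) \<and>
     (\<forall>F ts. is_instance S F \<and> finite F \<and> set ts \<subseteq> adom F \<and> length ts = length (free q) \<longrightarrow>
        (entails S F R q ts \<longleftrightarrow> (\<exists>q'\<in>Q. sat_cq F q' ts)))"

definition fus :: "'p sig \<Rightarrow> 'p rule set \<Rightarrow> bool" where
  "fus S R \<longleftrightarrow> (\<forall>q. is_cq S q \<longrightarrow> (\<exists>Q. is_rewriting S R q Q))"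

text \<open>
  Nodes of the infinite binary tree are words over \<open>bool\<close>: \<open>s @ [False]\<close> and \<open>s @ [True]\<close> are the
  left and right child of \<open>s\<close>.  \<open>Intro None k\<close> is the decorator \<open>*\<^sub>k\<close>, and \<open>Intro (Some c) k\<close> is
  \<open>c\<^sub>k\<close>.
\<close>

type_synonym node = "bool list"

datatype 'p decorator =
    Intro "nat option" nat
  | Add 'p "nat list"
  | Recolor nat nat
  | DisjUnion
  | Void

type_synonym 'p dtree = "node \<Rightarrow> 'p decorator"

fun is_decorator :: "'p sig \<Rightarrow> nat set \<Rightarrow> nat set \<Rightarrow> 'p decorator \<Rightarrow> bool" where
  "is_decorator S L Cnst (Intro x k) \<longleftrightarrow> set_option x \<subseteq> Cnst \<and> k \<in> L"
| "is_decorator S L Cnst (Add p ks) \<longleftrightarrow> p \<in> preds S \<and> length ks = arity S p \<and> set ks \<subseteq> L"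
| "is_decorator S L Cnst (Recolor k k') \<longleftrightarrow> k \<in> L \<and> k' \<in> L"
| "is_decorator S L Cnst DisjUnion \<longleftrightarrow> True"
| "is_decorator S L Cnst Void \<longleftrightarrow> True"

fun children_ok :: "'p decorator \<Rightarrow> 'p decorator \<Rightarrow> 'p decorator \<Rightarrow> bool" where
  "children_ok (Add p ks) l r \<longleftrightarrow> l \<noteq> Void \<and> r = Void"
| "children_ok (Recolor k k') l r \<longleftrightarrow> l \<noteq> Void \<and> r = Void"
| "children_ok DisjUnion l r \<longleftrightarrow> l \<noteq> Void \<and> r \<noteq> Void"
| "children_ok (Intro x k) l r \<longleftrightarrow> l = Void \<and> r = Void"
| "children_ok Void l r \<longleftrightarrow> l = Void \<and> r = Void"

definition well_decorated :: "'p sig \<Rightarrow> nat set \<Rightarrow> nat set \<Rightarrow> 'p dtree \<Rightarrow> bool" where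
  "well_decorated S L Cnst T \<longleftrightarrow>
     (\<forall>s. is_decorator S L Cnst (T s)) \<and>
     (\<forall>s s' c k k'. T s = Intro (Some c) k \<and> T s' = Intro (Some c) k' \<longrightarrow> s = s') \<and>
     (\<forall>s. children_ok (T s) (T (s @ [False])) (T (s @ [True])))"

text \<open>
  \<open>colored T s e k\<close>: the entity \<open>e\<close> is introduced in the subtree of \<open>s\<close> and has color \<open>k\<close> at \<open>s\<close>.
  In a well-decorated tree, \<open>k\<close> is uniquely determined by \<open>s\<close> and \<open>e\<close>.
\<close>

inductive colored :: "'p dtree \<Rightarrow> node \<Rightarrow> node trm \<Rightarrow> nat \<Rightarrow> bool" for T where
  null: "T s = Intro None k \<Longrightarrow> colored T s (Null s) k"
| const: "T s = Intro (Some c) k \<Longrightarrow> colored T s (Const c) k"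
| add: "T s = Add p ks \<Longrightarrow> colored T (s @ [False]) e i \<Longrightarrow> colored T s e i"
| recolor: "T s = Recolor k k' \<Longrightarrow> colored T (s @ [False]) e i \<Longrightarrow>
    colored T s e (if i = k then k' else i)"
| disj_union: "T s = DisjUnion \<Longrightarrow> colored T (s @ [b]) e i \<Longrightarrow> colored T s e i"

definition represented :: "'p sig \<Rightarrow> 'p dtree \<Rightarrow> ('p, node) inst" where
  "represented S T =
     {Atom (verum S) [e] | e. \<exists>k. colored T [] e k} \<union>
     {Atom p es | p es. \<exists>s ks. T s = Add p ks \<and> list_all2 (colored T s) es ks}"

definition represents ::
  "'p sig \<Rightarrow> 'p dtree \<Rightarrow> ('p, nat) inst \<Rightarrow> (nat trm \<Rightarrow> nat) \<Rightarrow> bool" where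
  "represents S T I col \<longleftrightarrow>
     (\<exists>f. iso I (represented S T) f \<and> (\<forall>t\<in>adom I. colored T [] (f t) (col t)))"

text \<open>The infimum of the empty set is \<open>\<infinity>\<close>.\<close>

definition cliquewidth :: "'p sig \<Rightarrow> ('p, nat) inst \<Rightarrow> enat" where
  "cliquewidth S I =
     Inf {enat (card L) | L.
       finite L \<and>
       (\<exists>Cnst T col. finite Cnst \<and> well_decorated S L Cnst T \<and> col ` adom I \<subseteq> L \<and>
          represents S T I col)}"

definition fcs :: "'p sig \<Rightarrow> 'p rule set \<Rightarrow> bool" where
  "fcs S R \<longleftrightarrow>
     (\<forall>D. is_database S D \<longrightarrow> (\<exists>U. universal_model S D R U \<and> cliquewidth S U < \<infinity>))"

end

theory Submission
  imports Defs "HOL-Library.Sublist" "HOL-Library.Nat_Bijection"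
begin

text \<open>
  Take a Skolem chase of the database.  Since heads are single atoms of arity at most two, a null is
  created together with one atom that links it to at most one older term.  The atoms of this form
  and the database make up the skeleton of the chase, which is a forest apart from finitely many
  roots.  All other atoms come from rules without existential variables, so they are entailed by the
  skeleton; as the rules are \<open>fus\<close>, the chase atoms of a predicate \<open>p\<close> are the answers over the
  skeleton to the finite rewriting of \<open>p(x, y)\<close>.  If the positions of \<open>x\<close> and \<open>y\<close> are farther
  apart than the size of the queries, then some edge of the forest between them is not used by a
  match, and cutting there shows that the atom depends only on finitely many unary types of \<open>x\<close> and
  \<open>y\<close>.  If they are close, colors that record short paths in the forest identify the pair.  A
  coloring of this kind gives a decorated tree with finitely many colors.
\<close>

section \<open>Decorated trees from colored addresses\<close>

fun recolor1 :: "'p decorator \<Rightarrow> nat \<Rightarrow> nat" where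
  "recolor1 (Recolor a b) k = (if k = a then b else k)"
| "recolor1 _ k = k"

abbreviation recolor_by :: "'p decorator list \<Rightarrow> nat \<Rightarrow> nat" where
  "recolor_by \<equiv> foldr recolor1"

text \<open>No target is a source, so a color that has been changed once is never changed again, and
  the successive recolorings act like a simultaneous one.\<close>

lemma recolor_by_map:
  assumes "\<And>a. a \<in> set ks \<Longrightarrow> g a \<notin> set ks"
  shows "recolor_by (map (\<lambda>a. Recolor a (g a)) ks) k = (if k \<in> set ks then g k else k)"
  using assms
proof (induction ks)
  case (Cons a ks)
  have "g a' \<notin> set ks" if "a' \<in> set ks" for a'
    using Cons.prems that by auto
  note IH = Cons.IH[OF this]
  show ?case using Cons.prems by (auto simp: IH)
qed simp

lemma recolor_by_idle:
  assumes "\<And>d. d \<in> set ops \<Longrightarrow> \<exists>p ks. d = Add p ks"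
  shows "recolor_by ops k = k"
  using assms
proof (induction ops)
  case (Cons d ops)
  from Cons.prems[of d] obtain p ks where "d = Add p ks" by auto
  then show ?case using Cons by auto
qed simp

definition list_of :: "'a set \<Rightarrow> 'a list" where
  "list_of A = (SOME l. set l = A)"

lemma set_list_of: "finite A \<Longrightarrow> set (list_of A) = A"
  unfolding list_of_def by (rule someI_ex) (rule finite_list)

text \<open>
  \<open>base s t\<close> is the color of \<open>t\<close> at position \<open>s\<close>.  Consecutive positions use disjoint color
  sets, so that a simultaneous recoloring can be carried out one color at a time.
\<close>

locale tree_coloring =
  fixes S :: "'p sig" and I :: "('p, nat) inst" and addr :: "nat trm \<Rightarrow> bool list"
    and base :: "bool list \<Rightarrow> nat trm \<Rightarrow> nat" and L :: "nat set"
  assumes finite_preds: "finite (preds S)"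
    and instI: "is_instance S I"
    and finite_L: "finite L"
    and finite_consts: "finite {c. Const c \<in> adom I}"
    and antichain: "\<lbrakk>t \<in> adom I; t' \<in> adom I; prefix (addr t) (addr t')\<rbrakk> \<Longrightarrow> t = t'"
    and base_in_L: "\<lbrakk>t \<in> adom I; prefix s (addr t)\<rbrakk> \<Longrightarrow> base s t \<in> L"
    and base_alternates: "\<lbrakk>t \<in> adom I; prefix (s @ [b]) (addr t); t' \<in> adom I; prefix (s @ [b]) (addr t')\<rbrakk>
      \<Longrightarrow> base s t \<noteq> base (s @ [b]) t'"
    and base_cong: "\<lbrakk>t \<in> adom I; prefix (s @ [b]) (addr t); t' \<in> adom I; prefix (s @ [b]) (addr t');
      base (s @ [b]) t = base (s @ [b]) t'\<rbrakk> \<Longrightarrow> base s t = base s t'"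
    and separated: "Atom p es \<in> I \<Longrightarrow> \<exists>s. (\<forall>e\<in>set es. prefix s (addr e)) \<and>
      (\<forall>es'. (\<forall>e\<in>set es'. e \<in> adom I \<and> prefix s (addr e)) \<longrightarrow> map (base s) es' = map (base s) es \<longrightarrow>
        Atom p es' \<in> I)"
begin

definition below :: "bool list \<Rightarrow> nat trm set" where
  "below s = {t \<in> adom I. prefix s (addr t)}"

definition leaf :: "bool list \<Rightarrow> bool" where
  "leaf s \<longleftrightarrow> (\<exists>t\<in>adom I. addr t = s)"

definition occupant :: "bool list \<Rightarrow> nat trm" where
  "occupant s = (SOME t. t \<in> adom I \<and> addr t = s)"

text \<open>Every addition that creates only atoms of \<open>I\<close> is made. Nothing wrong is
  thus ever added, and \<open>separated\<close> provides, for each atom, a position at which it is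
  added.\<close>

definition sound_adds :: "bool list \<Rightarrow> 'p decorator set" where
  "sound_adds s = {Add p ks | p ks. p \<in> preds S \<and> length ks = arity S p \<and> set ks \<subseteq> L \<and>
     (\<forall>es. set es \<subseteq> below s \<longrightarrow> map (base s) es = ks \<longrightarrow> Atom p es \<in> I)}"

text \<open>By \<open>base_cong\<close> the color does not depend on the chosen element.\<close>

definition lift_color :: "bool list \<Rightarrow> bool \<Rightarrow> nat \<Rightarrow> nat" where
  "lift_color s b k = base s (SOME t. t \<in> below (s @ [b]) \<and> base (s @ [b]) t = k)"

definition recolors :: "bool list \<Rightarrow> bool \<Rightarrow> 'p decorator list" where
  "recolors s b = map (\<lambda>k. Recolor k (lift_color s b k)) (list_of (base (s @ [b]) ` below (s @ [b])))"

text \<open>Earlier entries lie nearer to the root. The additions therefore see the colors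
  \<open>base s\<close>, and only above them are these turned into the colors of the parent
  position.\<close>

definition pending :: "bool list \<Rightarrow> 'p decorator list" where
  "pending s = (if s = [] then [] else recolors (butlast s) (last s)) @ list_of (sound_adds s)"

text \<open>
  The tree is the run of an automaton.  In state \<open>(ds, s)\<close> the decorators \<open>ds\<close> are still to be
  emitted, on a path to the left, before the node that introduces the element at address \<open>s\<close> or
  joins the two successors of \<open>s\<close>.
\<close>

fun out :: "('p decorator list \<times> bool list) option \<Rightarrow> 'p decorator" where
  "out None = Void"
| "out (Some (d # ds, s)) = d"
| "out (Some ([], s)) = (if leaf s
     then Intro (case occupant s of Const c \<Rightarrow> Some c | Null _ \<Rightarrow> None) (base s (occupant s))
     else DisjUnion)"

fun child :: "('p decorator list \<times> bool list) option \<Rightarrow> bool \<Rightarrow> ('p decorator list \<times> bool list) option" where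
  "child None b = None"
| "child (Some (d # ds, s)) b = (if b then None else Some (ds, s))"
| "child (Some ([], s)) b = (if leaf s then None else Some (pending (s @ [b]), s @ [b]))"

definition state :: "node \<Rightarrow> ('p decorator list \<times> bool list) option" where
  "state x = foldl child (Some (pending [], [])) x"

text \<open>A reached position with no element at or below it starts an infinite subtree without
  introductions. This keeps the children of every \<open>DisjUnion\<close> different from
  \<open>Void\<close>.\<close>

definition tree :: "'p dtree" where
  "tree x = out (state x)"

lemma state_Nil [simp]: "state [] = Some (pending [], [])"
  and state_snoc [simp]: "state (x @ [b]) = child (state x) b"
  by (simp_all add: state_def)

text \<open>The node at which the automaton starts to emit \<open>pending s\<close>, if no proper
  prefix of \<open>s\<close> is a leaf: for each of them, its decorators are passed first and then
  its branching node.\<close>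

definition entry :: "bool list \<Rightarrow> node" where
  "entry s = concat (map (\<lambda>i. replicate (length (pending (take i s))) False @ [s ! i]) [0..<length s])"

lemma entry_Nil [simp]: "entry [] = []"
  by (simp add: entry_def)

lemma entry_snoc [simp]: "entry (s @ [b]) = entry s @ replicate (length (pending s)) False @ [b]"
proof -
  have 1: "map (\<lambda>i. replicate (length (pending (take i (s @ [b])))) False @ [(s @ [b]) ! i]) [0..<length s]
      = map (\<lambda>i. replicate (length (pending (take i s))) False @ [s ! i]) [0..<length s]"
    by (intro map_cong) (auto simp: nth_append)
  have 2: "take (length s) (s @ [b]) = s" by simp
  show ?thesis by (simp add: entry_def 1 2 del: take_append)
qed

definition loc :: "nat trm \<Rightarrow> node" where
  "loc t = entry (addr t) @ replicate (length (pending (addr t))) False"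

fun emb :: "nat trm \<Rightarrow> node trm" where
  "emb (Const c) = Const c"
| "emb (Null n) = Null (loc (Null n))"

lemma below_snoc: "t \<in> below (s @ [b]) \<Longrightarrow> t \<in> below s"
  unfolding below_def using append_prefixD by blast

lemma occupant_eq: "t \<in> adom I \<Longrightarrow> occupant (addr t) = t"
proof -
  assume t: "t \<in> adom I"
  have "occupant (addr t) \<in> adom I \<and> addr (occupant (addr t)) = addr t"
    unfolding occupant_def by (rule someI_ex) (use t in auto)
  then show ?thesis using antichain t prefix_order.order_refl by metis
qed

text \<open>A leaf strictly above \<open>t\<close> would contradict \<open>antichain\<close>, so the
  automaton keeps branching on the way down to \<open>t\<close>.\<close>

lemma not_leaf_above: "t \<in> below (s @ [b]) \<Longrightarrow> \<not> leaf s"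
proof
  assume t: "t \<in> below (s @ [b])" and "leaf s"
  then obtain t' where t': "t' \<in> adom I" "addr t' = s" by (auto simp: leaf_def)
  then have "t' = t" using t below_snoc[OF t] antichain[of t' t] by (auto simp: below_def)
  then show False using t t' by (auto simp: below_def prefix_def)
qed

lemma finite_sound_adds: "finite (sound_adds s)"
proof -
  have "finite (\<Union>p\<in>preds S. Add p ` {ks. set ks \<subseteq> L \<and> length ks = arity S p})"
    using finite_preds finite_lists_length_eq[OF finite_L] by (intro finite_UN_I finite_imageI)
  then show ?thesis by (rule rev_finite_subset) (auto simp: sound_adds_def)
qed

lemma finite_base: "finite (base s ` below s)"
  using finite_L by (rule rev_finite_subset) (auto simp: below_def base_in_L)

lemma lift_color_eq: "t \<in> below (s @ [b]) \<Longrightarrow> lift_color s b (base (s @ [b]) t) = base s t"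
proof -
  assume t: "t \<in> below (s @ [b])"
  let ?u = "SOME u. u \<in> below (s @ [b]) \<and> base (s @ [b]) u = base (s @ [b]) t"
  have "?u \<in> below (s @ [b]) \<and> base (s @ [b]) ?u = base (s @ [b]) t"
    by (rule someI_ex) (use t in auto)
  then have "base s ?u = base s t"
    using t base_cong[of ?u s b t] unfolding below_def by blast
  then show ?thesis unfolding lift_color_def .
qed

lemma recolor_adds: "set ds \<subseteq> sound_adds s \<Longrightarrow> recolor_by ds k = k"
  by (rule recolor_by_idle) (auto simp: sound_adds_def)

text \<open>One edge of the address tree: the additions leave the color alone, and the recolorings
  act as the simultaneous map to the colors of the parent position.\<close>

lemma recolor_pending:
  assumes "t \<in> below (s @ [b])"
  shows "recolor_by (pending (s @ [b])) (base (s @ [b]) t) = base s t"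
proof -
  let ?ks = "list_of (base (s @ [b]) ` below (s @ [b]))"
  \<comment> \<open>Both colors are attained by elements below the same child, where
    \<open>base_alternates\<close> keeps the two levels apart.\<close>
  have "lift_color s b k \<notin> set ?ks" if k: "k \<in> set ?ks" for k
  proof -
    obtain u where u: "u \<in> below (s @ [b])" "k = base (s @ [b]) u"
      using k by (auto simp: set_list_of[OF finite_base])
    then have "base s u \<noteq> base (s @ [b]) u'" if "u' \<in> below (s @ [b])" for u'
      using base_alternates[of u s b u'] that by (simp add: below_def)
    then show ?thesis using u by (auto simp: set_list_of[OF finite_base] lift_color_eq)
  qed
  moreover have "base (s @ [b]) t \<in> set ?ks"
    using assms by (simp add: set_list_of[OF finite_base])
  ultimately have "recolor_by (recolors s b) (base (s @ [b]) t) = lift_color s b (base (s @ [b]) t)"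
    unfolding recolors_def by (subst recolor_by_map) auto
  then show ?thesis
    using assms by (simp add: pending_def recolor_adds[of _ "s @ [b]"] set_list_of[OF finite_sound_adds] lift_color_eq)
qed

lemma set_recolors:
  "d \<in> set (recolors s b) \<Longrightarrow> \<exists>k k'. d = Recolor k k' \<and> k \<in> L \<and> k' \<in> L"
  by (auto simp: recolors_def set_list_of[OF finite_base] lift_color_eq)
    (auto simp: below_def base_in_L append_prefixD)

lemma set_pending:
  assumes "d \<in> set (pending s)"
  shows "(\<exists>k k'. d = Recolor k k' \<and> k \<in> L \<and> k' \<in> L) \<or> d \<in> sound_adds s"
  using assms
  by (auto simp: pending_def set_list_of[OF finite_sound_adds] dest: set_recolors split: if_splits)

text \<open>The automaton can be run backwards: a state other than \<open>None\<close> occurs at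
  only one node. Hence no element is introduced twice.\<close>

lemma state_shape:
  "state x = Some (ds, s) \<Longrightarrow>
     \<exists>i\<le>length (pending s). ds = drop i (pending s) \<and> x = entry s @ replicate i False"
proof (induction x arbitrary: ds s rule: rev_induct)
  case Nil
  then show ?case by auto
next
  case (snoc b x)
  obtain ds' s' where st: "state x = Some (ds', s')"
    using snoc.prems by (cases "state x") auto
  then obtain i where i: "i \<le> length (pending s')" "ds' = drop i (pending s')"
    "x = entry s' @ replicate i False"
    using snoc.IH by blast
  have ch: "child (Some (ds', s')) b = Some (ds, s)" using snoc.prems st by simp
  show ?case
  proof (cases ds')
    case Nil
    then show ?thesis using ch i by (auto split: if_splits intro!: exI[of _ 0])
  next
    case (Cons d ds'')
    then have "\<not> b" "ds = ds''" "s = s'" using ch by (auto split: if_splits)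
    moreover have "i < length (pending s')" using Cons i by (metis drop_eq_Nil list.simps(3) not_le)
    moreover have "ds'' = drop (Suc i) (pending s')" using Cons i by (metis drop_Suc drop_tl list.sel(3))
    ultimately show ?thesis using i by (intro exI[of _ "Suc i"]) (auto simp: replicate_append_same)
  qed
qed

text \<open>The element \<open>t\<close> witnesses that no proper prefix of \<open>s\<close> is a
  leaf, so the run is not cut off before \<open>s\<close>.\<close>

lemma state_reach:
  assumes "t \<in> below s"
  shows "i \<le> length (pending s) \<Longrightarrow> state (entry s @ replicate i False) = Some (drop i (pending s), s)"
  using assms
proof (induction s arbitrary: i rule: rev_induct)
  case Nil
  from Nil(1) show ?case
  proof (induction i)
    case (Suc i)
    then have "drop i (pending []) = pending [] ! i # drop (Suc i) (pending [])"
      by (simp add: Cons_nth_drop_Suc)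
    then show ?case using Suc by (simp flip: replicate_append_same)
  qed simp
next
  case (snoc b s)
  have 0: "state (entry (s @ [b])) = Some (pending (s @ [b]), s @ [b])"
    using snoc.IH[of "length (pending s)"] below_snoc[OF snoc.prems(2)] not_leaf_above[OF snoc.prems(2)]
      state_snoc[of "entry s @ replicate (length (pending s)) False" b]
    by simp
  from snoc.prems(1) show ?case
  proof (induction i)
    case 0
    then show ?case using \<open>state (entry (s @ [b])) = _\<close> by simp
  next
    case (Suc i)
    then have "drop i (pending (s @ [b])) = pending (s @ [b]) ! i # drop (Suc i) (pending (s @ [b]))"
      by (simp add: Cons_nth_drop_Suc)
    then show ?case using Suc state_snoc[of "entry (s @ [b]) @ replicate i False" False]
      by (simp add: replicate_append_same del: state_snoc entry_snoc)
  qed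
qed

lemma state_loc: "t \<in> adom I \<Longrightarrow> state (loc t) = Some ([], addr t)"
  using state_reach[of t "addr t" "length (pending (addr t))"] by (simp add: loc_def below_def)

lemma state_leafD: "state x = Some ([], addr t) \<Longrightarrow> x = loc t"
  using state_shape[of x "[]" "addr t"] by (auto simp: loc_def)

lemma tree_Intro:
  assumes "tree x = Intro c k"
  obtains t where "t \<in> adom I" "state x = Some ([], addr t)" "x = loc t" "k = base (addr t) t"
    "c = (case t of Const c \<Rightarrow> Some c | Null _ \<Rightarrow> None)"
proof -
  obtain ds s where st: "state x = Some (ds, s)"
    using assms by (cases "state x") (auto simp: tree_def)
  have "ds = []"
  proof (cases ds)
    case (Cons d ds')
    then have "d \<in> set (pending s)"
      using state_shape[OF st] by (metis in_set_dropD list.set_intros(1))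
    then show ?thesis using assms st Cons set_pending[of d s] by (auto simp: tree_def sound_adds_def)
  qed
  then have leaf: "leaf s" using assms st by (auto simp: tree_def split: if_splits)
  then obtain t where t: "t \<in> adom I" "addr t = s" by (auto simp: leaf_def)
  then have "occupant s = t" using occupant_eq by auto
  then show ?thesis using that[of t] t leaf st assms \<open>ds = []\<close> state_leafD[of x t] by (auto simp: tree_def)
qed

lemma tree_unary:
  assumes "tree x = Add p ks \<or> tree x = Recolor a b"
  obtains ds s where "state x = Some (tree x # ds, s)"
  using assms
proof (cases "state x")
  case (Some a)
  then show ?thesis using assms that by (cases a; cases "fst a") (auto simp: tree_def split: if_splits)
qed (auto simp: tree_def)

lemma tree_DisjUnion:
  assumes "tree x = DisjUnion"
  obtains s where "state x = Some ([], s)" "\<not> leaf s"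
proof -
  obtain ds s where st: "state x = Some (ds, s)"
    using assms by (cases "state x") (auto simp: tree_def)
  have "ds = []"
  proof (cases ds)
    case (Cons d ds')
    then have "d \<in> set (pending s)"
      using state_shape[OF st] by (metis in_set_dropD list.set_intros(1))
    then show ?thesis using assms st Cons set_pending[of d s] by (auto simp: tree_def sound_adds_def)
  qed
  then show ?thesis using that assms st by (auto simp: tree_def split: if_splits)
qed

text \<open>The decorators in \<open>ds\<close> are emitted at \<open>x\<close> and below it, so
  they have already acted on the base color, the last one first.\<close>

lemma colored_sound:
  "colored tree x e k \<Longrightarrow>
     \<exists>ds s t. state x = Some (ds, s) \<and> t \<in> below s \<and> e = emb t \<and> k = recolor_by ds (base s t)"
proof (induction rule: colored.induct)
  case (null x k)
  then obtain t where t: "t \<in> adom I" "state x = Some ([], addr t)" "x = loc t" "k = base (addr t) t"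
    "None = (case t of Const c \<Rightarrow> Some c | Null _ \<Rightarrow> None)" by (rule tree_Intro)
  show ?case
    by (rule exI[of _ "[]"], rule exI[of _ "addr t"], rule exI[of _ t])
      (use t in \<open>cases t; auto simp: below_def\<close>)
next
  case (const x c k)
  then obtain t where t: "t \<in> adom I" "state x = Some ([], addr t)" "x = loc t" "k = base (addr t) t"
    "Some c = (case t of Const c \<Rightarrow> Some c | Null _ \<Rightarrow> None)" by (rule tree_Intro)
  show ?case
    by (rule exI[of _ "[]"], rule exI[of _ "addr t"], rule exI[of _ t])
      (use t in \<open>cases t; auto simp: below_def\<close>)
next
  case (add x p ks e i)
  then obtain ds s where "state x = Some (Add p ks # ds, s)" using tree_unary by metis
  then show ?case using add.IH by auto
next
  case (recolor x a b e i)
  then obtain ds s where "state x = Some (Recolor a b # ds, s)" using tree_unary by metis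
  then show ?case using recolor.IH by auto
next
  case (disj_union x b e i)
  from disj_union.hyps(1) obtain s where s: "state x = Some ([], s)" "\<not> leaf s" by (rule tree_DisjUnion)
  then obtain t where "t \<in> below (s @ [b])" "e = emb t"
    "i = recolor_by (pending (s @ [b])) (base (s @ [b]) t)"
    using disj_union.IH by auto
  then show ?case using s below_snoc recolor_pending by auto
qed

lemma colored_complete:
  assumes "t \<in> below s" "i \<le> length (pending s)"
  shows "colored tree (entry s @ replicate i False) (emb t) (recolor_by (drop i (pending s)) (base s t))"
  using assms
\<comment> \<open>The outer induction is on the part of the address below \<open>s\<close>; inside
  it, \<open>inc_induct\<close> climbs through \<open>pending s\<close> from its end.\<close>
proof (induction "length (addr t) - length s" arbitrary: s i rule: less_induct)
  case less
  let ?n = "length (pending s)"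
  have st: "state (entry s @ replicate j False) = Some (drop j (pending s), s)" if "j \<le> ?n" for j
    using state_reach less.prems(1) that by blast
  have base: "colored tree (entry s @ replicate ?n False) (emb t) (base s t)"
  proof (cases "s = addr t")
    case True
    have t: "t \<in> adom I" using less.prems by (simp add: below_def)
    then have "tree (loc t) = Intro (case t of Const c \<Rightarrow> Some c | Null _ \<Rightarrow> None) (base (addr t) t)"
      by (auto simp: tree_def state_loc occupant_eq leaf_def)
    then show ?thesis using True
      by (cases t) (auto simp flip: loc_def intro: colored.intros)
  next
    case False
    then obtain b where "prefix (s @ [b]) (addr t)"
      using less.prems unfolding below_def
      by (metis (no_types, lifting) mem_Collect_eq append_one_prefix prefix_length_less strict_prefix_def)
    then have b: "t \<in> below (s @ [b])" using less.prems by (simp add: below_def)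
    have "length (addr t) - length (s @ [b]) < length (addr t) - length s"
      using \<open>prefix (s @ [b]) (addr t)\<close> by (auto dest!: prefix_length_le)
    from less.hyps[OF this b, of 0]
    have "colored tree ((entry s @ replicate ?n False) @ [b]) (emb t) (base s t)"
      using recolor_pending[OF b] by simp
    moreover have "tree (entry s @ replicate ?n False) = DisjUnion"
      using st[of ?n] not_leaf_above[OF b] by (simp add: tree_def)
    ultimately show ?thesis by (rule colored.disj_union[rotated])
  qed
  from less.prems(2) show ?case
  proof (induction i rule: inc_induct)
    case base
    then show ?case using \<open>colored tree _ _ (base s t)\<close> by simp
  next
    case (step i)
    then have d: "drop i (pending s) = pending s ! i # drop (Suc i) (pending s)"
      by (simp add: Cons_nth_drop_Suc)
    have T: "tree (entry s @ replicate i False) = pending s ! i"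
      using st[of i] step d by (simp add: tree_def)
    have IH: "colored tree ((entry s @ replicate i False) @ [False]) (emb t)
      (recolor_by (drop (Suc i) (pending s)) (base s t))"
      using step.IH by (simp add: replicate_append_same)
    have "pending s ! i \<in> set (pending s)" using step by simp
    then consider k k' where "pending s ! i = Recolor k k'" | p ks where "pending s ! i = Add p ks"
      using set_pending[of "pending s ! i" s] by (auto simp: sound_adds_def)
    then show ?case
    proof cases
      case 1
      then show ?thesis using d T colored.recolor[OF _ IH] by auto
    next
      case 2
      then show ?thesis using d T colored.add[OF _ IH] by auto
    qed
  qed
qed

section \<open>Well-decoratedness and the represented instance\<close>

lemma tree_well_decorated: "well_decorated S L {c. Const c \<in> adom I} tree"
  unfolding well_decorated_def
proof (intro conjI allI impI)
  fix x
  show "is_decorator S L {c. Const c \<in> adom I} (tree x)"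
  proof (cases "tree x")
    case (Intro c k)
    then obtain t where "t \<in> adom I" "k = base (addr t) t"
      "c = (case t of Const c \<Rightarrow> Some c | Null _ \<Rightarrow> None)" by (rule tree_Intro)
    then show ?thesis using Intro by (cases t) (auto simp: base_in_L)
  next
    case (Add p ks)
    then obtain ds s where st: "state x = Some (Add p ks # ds, s)" using tree_unary by metis
    then have "Add p ks \<in> set (pending s)"
      using state_shape[OF st] by (metis in_set_dropD list.set_intros(1))
    then show ?thesis using Add set_pending by (fastforce simp: sound_adds_def)
  next
    case (Recolor a b)
    then obtain ds s where st: "state x = Some (Recolor a b # ds, s)" using tree_unary by metis
    then have "Recolor a b \<in> set (pending s)"
      using state_shape[OF st] by (metis in_set_dropD list.set_intros(1))
    then show ?thesis using Recolor set_pending by (fastforce simp: sound_adds_def)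
  qed auto
next
  fix x x' c k k'
  assume *: "tree x = Intro (Some c) k \<and> tree x' = Intro (Some c) k'"
  have "x = loc (Const c)" if "tree x = Intro (Some c) k" for x k
    using that by (rule tree_Intro) (auto split: trm.splits)
  then show "x = x'" using * by metis
next
  fix x
  have nv: "out (Some (ds, s)) \<noteq> Void" if "set ds \<subseteq> set (pending s)" for ds s
    using that by (cases ds) (auto simp: sound_adds_def dest: set_pending)
  show "children_ok (tree x) (tree (x @ [False])) (tree (x @ [True]))"
  proof (cases "state x")
    case (Some a)
    obtain ds s where a: "a = (ds, s)" by (cases a)
    then have sub: "set ds \<subseteq> set (pending s)" using state_shape[of x ds s] Some by (auto dest: in_set_dropD)
    show ?thesis
    proof (cases ds)
      case Nil
      then show ?thesis using Some a nv[of "pending (s @ [b])" "s @ [b]" for b] by (auto simp: tree_def)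
    next
      case (Cons d ds')
      then have "out (Some (ds', s)) \<noteq> Void" using sub by (intro nv) auto
      moreover have "(\<exists>k k'. d = Recolor k k') \<or> (\<exists>p ks. d = Add p ks)"
        using Cons sub set_pending[of d s] by (auto simp: sound_adds_def)
      ultimately show ?thesis using Some a Cons by (auto simp: tree_def)
    qed
  qed (simp add: tree_def)
qed

lemma inj_emb: "inj_on emb (adom I)"
proof (rule inj_onI)
  fix t t' assume t: "t \<in> adom I" "t' \<in> adom I" and eq: "emb t = emb t'"
  show "t = t'"
  proof (cases t)
    case (Null n)
    with eq have "loc t = loc t'" by (cases t') auto
    then have "addr t = addr t'" using t state_loc by (metis option.inject prod.inject)
    then show ?thesis using antichain t by auto
  qed (use eq in \<open>cases t'; auto\<close>)
qed

lemma represented_tree: "represented S tree = apply_atom emb ` I"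
proof
  show "represented S tree \<subseteq> apply_atom emb ` I"
  proof
    fix a assume "a \<in> represented S tree"
    then consider e k where "a = Atom (verum S) [e]" "colored tree [] e k"
      | p es x ks where "a = Atom p es" "tree x = Add p ks" "list_all2 (colored tree x) es ks"
      by (auto simp: represented_def)
    then show "a \<in> apply_atom emb ` I"
    proof cases
      case 1
      then obtain t where "t \<in> adom I" "e = emb t" using colored_sound[of "[]" e k] by (auto simp: below_def)
      then show ?thesis using 1 instI by (auto simp: is_instance_def intro!: image_eqI[of _ _ "Atom (verum S) [t]"])
    next
      case 2
      then obtain ds s where st: "state x = Some (Add p ks # ds, s)" using tree_unary by metis
      then obtain i where i: "Add p ks # ds = drop i (pending s)" using state_shape by blast
      let ?rs = "if s = [] then [] else recolors (butlast s) (last s)"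
      \<comment> \<open>The \<open>Add\<close> lies behind all recolorings of
        \<open>pending s\<close>, and so does the rest \<open>ds\<close>; hence the colors at
        \<open>x\<close> are still the base colors at \<open>s\<close>.\<close>
      have "\<not> i < length ?rs"
      proof
        assume lt: "i < length ?rs"
        then have "i < length (pending s)" "pending s ! i = ?rs ! i"
          by (simp_all only: pending_def length_append nth_append if_True)
        then have "Add p ks = ?rs ! i"
          using i by (simp flip: Cons_nth_drop_Suc)
        then have "Add p ks \<in> set ?rs" using nth_mem[OF lt] by simp
        then show False by (auto dest: set_recolors split: if_splits)
      qed
      then have "set (Add p ks # ds) \<subseteq> set (list_of (sound_adds s))"
        unfolding i pending_def by (auto dest: in_set_dropD)
      then have sub: "Add p ks \<in> sound_adds s" "set ds \<subseteq> sound_adds s"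
        by (auto simp: set_list_of[OF finite_sound_adds])
      have col: "\<exists>t\<in>below s. e = emb t \<and> k = base s t" if "colored tree x e k" for e k
        using colored_sound[OF that] st recolor_adds[OF sub(2)] by auto
      have "\<exists>ts. set ts \<subseteq> below s \<and> es = map emb ts \<and> map (base s) ts = ks"
        using 2(3)
      proof (induction rule: list_all2_induct)
        case (Cons e es k ks)
        then obtain ts t where "set ts \<subseteq> below s \<and> es = map emb ts \<and> map (base s) ts = ks"
          "t \<in> below s" "e = emb t" "k = base s t" using col by blast
        then show ?case by (intro exI[of _ "t # ts"]) auto
      qed simp
      then obtain ts where ts: "set ts \<subseteq> below s" "es = map emb ts" "map (base s) ts = ks" by blast
      then have "Atom p ts \<in> I" using sub(1) by (auto simp: sound_adds_def)
      then show ?thesis using 2 ts by (auto intro!: image_eqI[of _ _ "Atom p ts"])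
    qed
  qed
next
  show "apply_atom emb ` I \<subseteq> represented S tree"
  proof (safe)
    fix a assume a: "a \<in> I"
    obtain p es where pes: "a = Atom p es" by (cases a)
    have adom: "e \<in> adom I" if "e \<in> set es" for e using a pes that by (force simp: adom_def)
    obtain s where s: "\<forall>e\<in>set es. prefix s (addr e)"
      and sep: "\<forall>es'. (\<forall>e\<in>set es'. e \<in> adom I \<and> prefix s (addr e)) \<longrightarrow> map (base s) es' = map (base s) es \<longrightarrow>
        Atom p es' \<in> I"
      using separated a pes by metis
    \<comment> \<open>For a nullary atom, \<open>s\<close> is arbitrary and may be unreachable; such
      an atom is added at the root.\<close>
    define r where "r = (if es = [] then [] else s)"
    have r: "set es \<subseteq> below r" using s adom by (auto simp: r_def below_def)
    let ?d = "Add p (map (base r) es)"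
    have "?d \<in> sound_adds r"
    proof -
      have "is_atom S (Atom p es)" using a pes instI by (simp add: is_instance_def)
      moreover have "base r ` set es \<subseteq> L" using r base_in_L by (auto simp: below_def)
      moreover have "Atom p ts \<in> I" if "set ts \<subseteq> below r" "map (base r) ts = map (base r) es" for ts
      proof (cases "es = []")
        case False
        then show ?thesis using sep that by (auto simp: r_def below_def subset_iff)
      qed (use that a pes in simp)
      ultimately show ?thesis by (simp add: sound_adds_def is_atom_def)
    qed
    then have "?d \<in> set (list_of (sound_adds r))" by (simp add: set_list_of[OF finite_sound_adds])
    then obtain j where j: "j < length (list_of (sound_adds r))" "list_of (sound_adds r) ! j = ?d"
      by (auto simp: in_set_conv_nth)
    define i where "i = length (pending r) - length (list_of (sound_adds r)) + j"
    have i: "i < length (pending r)" "pending r ! i = ?d"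
      using j by (auto simp: i_def pending_def nth_append)
    have dr: "set (drop i (pending r)) \<subseteq> sound_adds r"
      by (auto simp: i_def pending_def set_list_of[OF finite_sound_adds] dest!: in_set_dropD)
    let ?x = "entry r @ replicate i False"
    have st: "state ?x = Some (drop i (pending r), r)"
    proof (cases "es = []")
      case True
      \<comment> \<open>\<open>state_reach\<close> asks for an element below the position, and an
        instance of nullary atoms has none.\<close>
      have "state (replicate j False) = Some (drop j (pending []), [])" if "j \<le> length (pending [])" for j
        using that
      proof (induction j)
        case (Suc j)
        then have "drop j (pending []) = pending [] ! j # drop (Suc j) (pending [])"
          by (simp add: Cons_nth_drop_Suc)
        then show ?case using Suc by (simp flip: replicate_append_same)
      qed simp
      then show ?thesis using i True by (simp add: r_def)
    next
      case False
      then show ?thesis using r i state_reach[of "hd es" r i] by (auto simp: subset_iff)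
    qed
    have "tree ?x = ?d" using st i by (simp add: tree_def flip: Cons_nth_drop_Suc)
    moreover have "list_all2 (colored tree ?x) (map emb es) (map (base r) es)"
    proof -
      have "colored tree ?x (emb e) (base r e)" if "e \<in> set es" for e
        using colored_complete[of e r i] r that i recolor_adds[OF dr] by auto
      then show ?thesis by (simp add: list_all2_conv_all_nth)
    qed
    ultimately show "apply_atom emb a \<in> represented S tree"
      unfolding represented_def pes by auto
  qed
qed

lemma adom_image: "adom (apply_atom h ` X) = h ` adom X"
  by (auto simp: adom_def atom.map_sel)

theorem cliquewidth_finite: "cliquewidth S I < \<infinity>"
proof -
  let ?J = "represented S tree"
  have adomJ: "adom ?J = emb ` adom I" by (simp add: represented_tree adom_image)
  have inv: "inv_into (adom I) emb (emb t) = t" if "t \<in> adom I" for t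
    using inj_emb that by simp
  have "iso I ?J emb"
    unfolding iso_def
  proof (intro conjI)
    show "bij_betw emb (adom I) (adom ?J)" using inj_emb adomJ by (simp add: bij_betw_def)
    show "hom I ?J emb" by (auto simp: hom_def represented_tree)
    have "inv_into (adom I) emb (Const c) = Const c" if c: "Const c \<in> adom ?J" for c
    proof -
      obtain t where t: "t \<in> adom I" "Const c = emb t" using c adomJ by auto
      then have "t = Const c" by (cases t) auto
      then show ?thesis using t inv by metis
    qed
    moreover have "apply_atom (inv_into (adom I) emb) (apply_atom emb a) = a" if "a \<in> I" for a
    proof -
      have "map (inv_into (adom I) emb \<circ> emb) (args a) = args a"
      proof (rule map_idI)
        fix t assume "t \<in> set (args a)"
        then have "t \<in> adom I" using that by (auto simp: adom_def)
        then show "(inv_into (adom I) emb \<circ> emb) t = t" by (simp add: inv)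
      qed
      then show ?thesis by (cases a) simp
    qed
    ultimately show "hom ?J I (inv_into (adom I) emb)"
      by (auto simp: hom_def represented_tree)
  qed
  moreover define col where "col t = recolor_by (pending []) (base [] t)" for t
  have "colored tree [] (emb t) (col t)" if "t \<in> adom I" for t
    using colored_complete[of t "[]" 0] that by (simp add: col_def below_def)
  moreover have "col ` adom I \<subseteq> L"
    by (auto simp: col_def pending_def recolor_adds[of _ "[]"] set_list_of[OF finite_sound_adds] base_in_L)
  ultimately have "represents S tree I col" "col ` adom I \<subseteq> L"
    unfolding represents_def by auto
  then have "\<exists>Cnst T col. finite Cnst \<and> well_decorated S L Cnst T \<and> col ` adom I \<subseteq> L \<and>
      represents S T I col"
    using finite_consts tree_well_decorated by iprover
  then have "cliquewidth S I \<le> enat (card L)"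
    unfolding cliquewidth_def using finite_L by (intro Inf_lower) auto
  then show ?thesis by (metis enat_ord_code(4) order_le_less_trans)
qed

end

section \<open>Atoms on far and near pairs\<close>

lemma list_le_2_cases:
  assumes "length vs \<le> 2"
  obtains "vs = []" | x where "vs = [x]" | x y where "vs = [x, y]"
proof (cases vs)
  case Nil
  then show ?thesis using that by simp
next
  case (Cons x xs)
  then show ?thesis
  proof (cases xs)
    case (Cons y ys)
    then show ?thesis using \<open>vs = x # xs\<close> assms that(3)[of x y] by simp
  qed (use that \<open>vs = x # xs\<close> in simp)
qed

text \<open>
  A pair is separated at the longest common prefix \<open>s\<close> of its addresses.  If it is far, \<open>c\<close> decides
  its atoms; otherwise both colors contain the remaining path, so they determine the pair.
\<close>

lemma cliquewidth_finite_if_far_determined: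
  fixes I :: "('p, nat) inst" and addr :: "nat trm \<Rightarrow> bool list" and c :: "nat trm \<Rightarrow> 'c"
  assumes preds: "finite (preds S)" and bin: "at_most_binary S" and inst: "is_instance S I"
    and fin_consts: "finite {c. Const c \<in> adom I}"
    and antichain: "\<And>t t'. \<lbrakk>t \<in> adom I; t' \<in> adom I; prefix (addr t) (addr t')\<rbrakk> \<Longrightarrow> t = t'"
    and fin_c: "finite (c ` adom I)"
    and far: "\<And>p e e' s b b' u v f f'. \<lbrakk>Atom p [e, e'] \<in> I; addr e = s @ b # u; addr e' = s @ b' # v; b \<noteq> b';
      length u \<ge> m \<or> length v \<ge> m; f \<in> adom I; f' \<in> adom I; c f = c e; c f' = c e'\<rbrakk>
      \<Longrightarrow> Atom p [f, f'] \<in> I"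
  shows "cliquewidth S I < \<infinity>"
proof -
  \<comment> \<open>The path from \<open>s\<close> to the address of \<open>t\<close>, kept only up
    to length \<open>m\<close> so that finitely many values occur.\<close>
  define rel :: "bool list \<Rightarrow> nat trm \<Rightarrow> bool list option" where "rel s t = (let u = drop (length s) (addr t) in if length u \<le> m then Some u else None)" for s t
  define K :: "('c \<times> bool list option \<times> bool) set" where
    "K = c ` adom I \<times> insert None (Some ` {u. length u \<le> m}) \<times> UNIV"
  have "finite {u :: bool list. length u \<le> m}"
    using finite_lists_length_le[OF finite, of "UNIV :: bool set" m] by (simp only: subset_UNIV simp_thms)
  then have "finite K" unfolding K_def
    by (intro finite_cartesian_product fin_c finite.insertI finite_imageI finite)
  from finite_imp_inj_to_nat_seg[OF this]
  obtain \<phi> :: "_ \<Rightarrow> nat" where \<phi>: "inj_on \<phi> K" by (elim exE conjE)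
  \<comment> \<open>The parity of the depth makes the colors of consecutive positions
    disjoint.\<close>
  define base :: "bool list \<Rightarrow> nat trm \<Rightarrow> nat" where "base s t = \<phi> (c t, rel s t, odd (length s))" for s t
  have in_K: "(c t, rel s t, x) \<in> K" if "t \<in> adom I" for s t x
    using that by (auto simp: K_def rel_def Let_def)
  have base_eq: "base s t = base s' t' \<longleftrightarrow>
      c t = c t' \<and> rel s t = rel s' t' \<and> odd (length s) = odd (length s')"
    if "t \<in> adom I" "t' \<in> adom I" for s s' t t'
    using inj_on_eq_iff[OF \<phi> in_K[OF that(1)] in_K[OF that(2)]] by (simp add: base_def)
  interpret tree_coloring S I addr base "\<phi> ` K"
  proof
    fix s b t t'
    assume t: "t \<in> adom I" "prefix (s @ [b]) (addr t)" "t' \<in> adom I" "prefix (s @ [b]) (addr t')"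
    show "base s t \<noteq> base (s @ [b]) t'" using t by (simp add: base_eq)
    assume eq: "base (s @ [b]) t = base (s @ [b]) t'"
    \<comment> \<open>The path from \<open>s\<close> is that from \<open>s @ [b]\<close> with
      \<open>b\<close> in front, so equal values of \<open>rel\<close> below give equal values
      above, \<open>None\<close> included.\<close>
    obtain u u' where "addr t = s @ b # u" "addr t' = s @ b # u'"
      using t by (auto simp: prefix_def)
    then show "base s t = base s t'"
      using eq t by (auto simp: base_eq rel_def split: if_splits)
  next
    fix p es assume a: "Atom p es \<in> I"
    have adom: "e \<in> adom I" if "e \<in> set es" for e using a that by (force simp: adom_def)
    \<comment> \<open>If only one element occurs, its own address separates: by
      \<open>antichain\<close> nothing else lies below it.\<close>
    have at: "\<exists>s. (\<forall>e\<in>set es. prefix s (addr e)) \<and>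
      (\<forall>es'. (\<forall>e\<in>set es'. e \<in> adom I \<and> prefix s (addr e)) \<longrightarrow> map (base s) es' = map (base s) es \<longrightarrow>
        Atom p es' \<in> I)" if "set es = {e}" for e
    proof (intro exI[of _ "addr e"] conjI allI impI)
      fix es' assume *: "\<forall>e'\<in>set es'. e' \<in> adom I \<and> prefix (addr e) (addr e')"
        "map (base (addr e)) es' = map (base (addr e)) es"
      have "x = e" if "x \<in> set es'" for x
        using * antichain[of e x] adom \<open>set es = {e}\<close> that by blast
      then have "es' = replicate (length es') e" by (intro replicate_eqI) auto
      moreover have "es = replicate (length es) e"
        using that by (intro replicate_eqI) auto
      moreover have "length es' = length es" using *(2) by (metis length_map)
      ultimately have "es' = es" by argo
      then show "Atom p es' \<in> I" using a by simp
    qed (use that in auto)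
    have "length es \<le> 2"
      using a inst bin by (auto simp: is_instance_def is_atom_def at_most_binary_def)
    then consider "es = []" | e where "es = [e]" | e where "es = [e, e]" | e e' where "es = [e, e']" "e \<noteq> e'"
    proof (cases rule: list_le_2_cases)
      case (3 x y)
      then show ?thesis using that(3)[of x] that(4)[of x y] by (cases "x = y") auto
    qed (use that in blast)+
    then show "\<exists>s. (\<forall>e\<in>set es. prefix s (addr e)) \<and>
      (\<forall>es'. (\<forall>e\<in>set es'. e \<in> adom I \<and> prefix s (addr e)) \<longrightarrow> map (base s) es' = map (base s) es \<longrightarrow>
        Atom p es' \<in> I)"
    proof cases
      case 1
      then show ?thesis using a by (intro exI[of _ "[]"]) auto
    next
      case 4
      then have ad: "e \<in> adom I" "e' \<in> adom I" using adom by auto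
      then have "addr e \<parallel> addr e'" using 4 antichain[of e e'] antichain[of e' e] by (auto simp: parallel_def)
      from parallel_decomp[OF this]
      obtain s b u b' v where s: "b \<noteq> b'" "addr e = s @ b # u" "addr e' = s @ b' # v"
        by (elim exE conjE)
      show ?thesis
      proof (intro exI[of _ s] conjI allI impI)
        fix es' assume *: "\<forall>e\<in>set es'. e \<in> adom I \<and> prefix s (addr e)"
          "map (base s) es' = map (base s) es"
        obtain f f' where es': "es' = [f, f']" "base s f = base s e" "base s f' = base s e'"
          using *(2) 4 by auto
        then have f: "f \<in> adom I" "f' \<in> adom I" "prefix s (addr f)" "prefix s (addr f')"
          using *(1) by auto
        have eq: "c f = c e" "rel s f = rel s e" "c f' = c e'" "rel s f' = rel s e'"
          using es' f ad by (simp_all add: base_eq)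
        show "Atom p es' \<in> I"
        proof (cases "length u \<ge> m \<or> length v \<ge> m")
          case True
          show ?thesis using far[OF _ s(2,3,1) True f(1,2) eq(1,3)] a 4 es' by simp
        next
          case False
          obtain w w' where w: "addr f = s @ w" "addr f' = s @ w'" using f by (elim prefixE)
          \<comment> \<open>\<open>length u < m\<close> means \<open>length (b # u) \<le> m\<close>,
            so the colors record both paths completely.\<close>
          have "rel s e = Some (b # u)" "rel s e' = Some (b' # v)"
            using False s by (simp_all add: rel_def)
          then have "w = b # u" "w' = b' # v"
            using eq w by (simp_all add: rel_def Let_def split: if_splits)
          then have "prefix (addr f) (addr e)" "prefix (addr f') (addr e')" using s w by simp_all
          then have "f = e" "f' = e'" using antichain[of f e] antichain[of f' e'] f ad by blast+
          then show ?thesis using a 4 es' by simp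
        qed
      next
        show "\<forall>x\<in>set es. prefix s (addr x)" using 4(1) s by auto
      qed
    next
      case (2 e)
      then show ?thesis using at[of e] by simp
    next
      case (3 e)
      then show ?thesis using at[of e] by simp
    qed
  next
    fix t t' assume "t \<in> adom I" "t' \<in> adom I" "prefix (addr t) (addr t')"
    then show "t = t'" by (rule antichain)
  next
    fix s t assume "t \<in> adom I"
    then show "base s t \<in> \<phi> ` K" unfolding base_def by (intro imageI in_K)
  next
    show "finite (\<phi> ` K)" using \<open>finite K\<close> by (rule finite_imageI)
  qed (fact preds inst fin_consts)+
  show ?thesis by (rule cliquewidth_finite)
qed

section \<open>The Skolem chase and its skeleton\<close>

text \<open>Constants are roots of the forest as well; their odd letter keeps them apart from the
  even letter of \<open>root p i\<close>.\<close>

fun word :: "nat trm \<Rightarrow> nat list" where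
  "word (Const c) = [2 * c + 1]"
| "word (Null n) = list_decode n"

lemma sat_ruleE:
  assumes "sat_rule M r" "\<And>b. b \<in> body r \<Longrightarrow> apply_atom h b \<in> M" "head r = {Atom p vs}"
  obtains g where "\<And>v. v \<in> adom (body r) \<Longrightarrow> g v = h v" "Atom p (map g vs) \<in> M"
proof -
  have "apply_atom h ` body r \<subseteq> M" using assms(2) by (rule image_subsetI)
  from assms(1)[unfolded sat_rule_def, rule_format, OF this] assms(3) that
  show thesis by force
qed

locale binary_rules =
  fixes S :: "'p sig" and R :: "'p rule set" and D :: "('p, nat) inst" and \<iota> :: "'p \<Rightarrow> nat"
  assumes sig: "is_sig S" and binary: "at_most_binary S"
    and rules: "r \<in> R \<Longrightarrow> is_rule S r" and heads: "r \<in> R \<Longrightarrow> single_headed r"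
    and db: "is_database S D"
    and inj: "inj_on \<iota> (preds S)"
begin

text \<open>
  Nulls are named by the shape of the head that creates them, not by the rule or the body match:
  \<open>root p i\<close> when the head has no frontier variable, \<open>succ t p d\<close> when its frontier is \<open>t\<close>
  (in the first argument iff \<open>d\<close>).  Hence \<open>word\<close> arranges all terms in a forest over a finite
  alphabet, even for an infinite set of rules.
\<close>

definition root :: "'p \<Rightarrow> nat \<Rightarrow> nat trm" where
  "root p i = Null (list_encode [2 * (3 * \<iota> p + i)])"

definition succ :: "nat trm \<Rightarrow> 'p \<Rightarrow> bool \<Rightarrow> nat trm" where
  "succ t p d = Null (list_encode (word t @ [2 * \<iota> p + of_bool d]))"

lemma word_root [simp]: "word (root p i) = [2 * (3 * \<iota> p + i)]"
  and word_succ [simp]: "word (succ t p d) = word t @ [2 * \<iota> p + of_bool d]"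
  by (simp_all add: root_def succ_def)

text \<open>\<open>root p 0\<close> serves a head whose only variable is existential, be it unary or
  binary; \<open>root p 1\<close> and \<open>root p 2\<close> are the two nulls of a head with two
  distinct existential variables.\<close>

fun skolem :: "nat set \<Rightarrow> 'p \<Rightarrow> nat list \<Rightarrow> (nat \<Rightarrow> nat trm) \<Rightarrow> nat \<Rightarrow> nat trm" where
  "skolem Y p [x, y] h z =
     (if z \<in> Y then h z
      else if x \<in> Y then succ (h x) p True
      else if y \<in> Y then succ (h y) p False
      else if x = y then root p 0
      else root p (if z = x then 1 else 2))"
| "skolem Y p vs h z = (if z \<in> Y then h z else root p 0)"

lemma skolem_frontier: "z \<in> Y \<Longrightarrow> skolem Y p vs h z = h z"
  by (cases "(Y, p, vs, h, z)" rule: skolem.cases) auto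

inductive_set chase :: "('p, nat) inst" where
  database: "a \<in> D \<Longrightarrow> a \<in> chase"
| verum: "a \<in> chase \<Longrightarrow> t \<in> set (args a) \<Longrightarrow> Atom (verum S) [t] \<in> chase"
| rule: "r \<in> R \<Longrightarrow> head r = {Atom p vs} \<Longrightarrow> (\<And>b. b \<in> body r \<Longrightarrow> apply_atom h b \<in> chase) \<Longrightarrow>
    Atom p (map (skolem (adom (body r)) p vs h) vs) \<in> chase"

lemma head_atom:
  assumes "r \<in> R" "head r = {Atom p vs}"
  shows "p \<in> preds S" "length vs = arity S p" "length vs \<le> 2"
  using rules[OF assms(1)] assms(2) binary by (auto simp: is_rule_def is_atom_def at_most_binary_def)

lemma args_apply_atom [simp]: "args (apply_atom h a) = map h (args a)"
  by (cases a) simp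

lemma chase_term_induct:
  assumes "a \<in> chase" "t \<in> set (args a)"
    and D: "\<And>c. Const c \<in> adom D \<Longrightarrow> P (Const c)"
    and root: "\<And>p i. p \<in> preds S \<Longrightarrow> i < 3 \<Longrightarrow> P (root p i)"
    and succ: "\<And>t p d. P t \<Longrightarrow> p \<in> preds S \<Longrightarrow> P (succ t p d)"
  shows "P t"
  using assms(1,2)
proof (induction arbitrary: t)
  case (database a)
  then have "t \<in> adom D" by (auto simp: adom_def)
  then show ?case using D db by (auto simp: is_database_def)
next
  case (rule r p vs h)
  have p: "p \<in> preds S" and len: "length vs \<le> 2" using head_atom[OF rule(1,2)] by auto
  have h: "P (h v)" if v: "v \<in> adom (body r)" for v
  proof -
    obtain b where b: "b \<in> body r" "v \<in> set (args b)" using v by (auto simp: adom_def)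
    then show ?thesis using rule.IH[OF b(1), of "h v"] by simp
  qed
  obtain z where z: "z \<in> set vs" "t = skolem (adom (body r)) p vs h z" using rule.prems by auto
  from len show ?case
    by (cases rule: list_le_2_cases) (use z h p root succ in \<open>auto split: if_splits\<close>)
qed auto

lemma is_atom_chase: "a \<in> chase \<Longrightarrow> is_atom S a"
proof (induction rule: chase.induct)
  case (database a)
  then show ?case
    using db by (simp add: is_database_def is_instance_def)
next
  case (verum a t)
  then show ?case using sig by (simp add: is_atom_def is_sig_def)
next
  case (rule r p vs h)
  then show ?case using head_atom[OF rule(1,2)] by (simp add: is_atom_def)
qed

lemma head_cases:
  assumes "r \<in> R"
  obtains p vs where "head r = {Atom p vs}"
  using heads[OF assms] by (metis atom.exhaust single_headed_def)

lemma chase_model: "is_model S D R chase"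
  unfolding is_model_def is_instance_def sat_rule_def
proof (intro conjI ballI allI impI)
  fix t assume "t \<in> adom chase"
  then show "Atom (verum S) [t] \<in> chase" by (auto simp: adom_def intro: chase.verum)
next
  fix r h assume r: "r \<in> R" and h: "apply_atom h ` body r \<subseteq> chase"
  obtain p vs where hd: "head r = {Atom p vs}" using head_cases[OF r] .
  have "Atom p (map (skolem (adom (body r)) p vs h) vs) \<in> chase"
    using r hd h by (intro chase.rule) auto
  then show "\<exists>g. (\<forall>v\<in>adom (body r). g v = h v) \<and> apply_atom g ` head r \<subseteq> chase"
    by (intro exI[of _ "skolem (adom (body r)) p vs h"]) (simp add: hd skolem_frontier)
qed (auto intro: is_atom_chase chase.database)

section \<open>The forest of chase terms\<close>

lemma word_nonempty: "a \<in> chase \<Longrightarrow> t \<in> set (args a) \<Longrightarrow> word t \<noteq> []"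
  by (erule chase_term_induct) auto

text \<open>Roots differ from constants by parity, successors by having at least two
  letters.\<close>

lemma null_word: "a \<in> chase \<Longrightarrow> t \<in> set (args a) \<Longrightarrow> t = Null n \<Longrightarrow> word t \<noteq> [2 * c + 1]"
proof -
  assume a: "a \<in> chase" "t \<in> set (args a)" "t = Null n"
  have "word t \<noteq> [] \<and> (t \<notin> range Const \<longrightarrow> word t \<noteq> [2 * c + 1])"
    using a(1,2)
  proof (rule chase_term_induct)
    fix p and i :: nat
    have "2 * (3 * \<iota> p + i) \<noteq> 2 * c + 1" by presburger
    then show "word (root p i) \<noteq> [] \<and> (root p i \<notin> range Const \<longrightarrow> word (root p i) \<noteq> [2 * c + 1])"
      by simp
  qed auto
  then show ?thesis using a by auto
qed

lemma inj_word: "inj_on word (adom chase)"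
proof (rule inj_onI)
  fix t t' assume t: "t \<in> adom chase" "t' \<in> adom chase" and eq: "word t = word t'"
  from t obtain a a' where a: "a \<in> chase" "t \<in> set (args a)" "a' \<in> chase" "t' \<in> set (args a')"
    by (auto simp: adom_def)
  show "t = t'"
  proof (cases t; cases t')
    fix n n' assume "t = Null n" "t' = Null n'"
    then show ?thesis using eq by (metis list_decode_inverse word.simps(2))
  next
    fix m n assume "t = Const m" "t' = Null n"
    then show ?thesis using eq null_word[OF a(3,4)] by (metis word.simps(1))
  next
    fix m n assume "t = Null n" "t' = Const m"
    then show ?thesis using eq null_word[OF a(1,2)] by (metis word.simps(1))
  qed (use eq in simp)
qed

text \<open>The letters depend on \<open>D\<close> and the signature only. The bound later makes
  unary codes linear in the length of the words.\<close>

lemma finite_letters: "\<exists>n. \<forall>t\<in>adom chase. \<forall>x\<in>set (word t). x \<le> n"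
proof -
  have D: "finite D" using db by (simp add: is_database_def)
  have P: "finite (preds S)" using sig by (simp add: is_sig_def)
  define A where "A = (\<Union>t\<in>adom D. set (word t)) \<union> (\<Union>p\<in>preds S. \<Union>i\<in>{..<3}. {2 * (3 * \<iota> p + i)}) \<union>
    (\<Union>p\<in>preds S. \<Union>d. {2 * \<iota> p + of_bool d})"
  have "finite A" using D P by (simp add: A_def adom_def)
  have "set (word t) \<subseteq> A" if t: "t \<in> adom chase" for t
  proof -
    obtain a where a: "a \<in> chase" "t \<in> set (args a)" using t by (auto simp: adom_def)
    then show ?thesis
    proof (rule chase_term_induct)
      show "set (word (Const c)) \<subseteq> A" if "Const c \<in> adom D" for c
        using that unfolding A_def by blast
      show "set (word (root p i)) \<subseteq> A" if "p \<in> preds S" "i < 3" for p i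
        using that unfolding A_def word_root by auto
      show "set (word (succ t p d)) \<subseteq> A" if "set (word t) \<subseteq> A" "p \<in> preds S" for t p d
      proof -
        have "2 * \<iota> p + of_bool d \<in> A" using that unfolding A_def by blast
        then show ?thesis using that by simp
      qed
    qed
  qed
  then show ?thesis using Max_ge[OF \<open>finite A\<close>] by blast
qed

lemma finite_consts: "finite {c. Const c \<in> adom chase}"
proof -
  obtain n where n: "\<forall>t\<in>adom chase. \<forall>x\<in>set (word t). x \<le> n" using finite_letters by blast
  have "{c. Const c \<in> adom chase} \<subseteq> {..n}" using n by fastforce
  then show ?thesis by (rule finite_subset) simp
qed

section \<open>Universality of the chase\<close>

text \<open>The list is the word of a chase term in reversed order.\<close>

fun image_term :: "('p, nat) inst \<Rightarrow> nat list \<Rightarrow> nat trm" where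
  "image_term M [] = undefined"
| "image_term M [x] = (if odd x then Const (x div 2) else
     let p = inv_into (preds S) \<iota> (x div 2 div 3) in
     if x div 2 mod 3 = 0 then SOME u. Atom p (replicate (arity S p) u) \<in> M
     else (if x div 2 mod 3 = 1 then fst else snd) (SOME u. Atom p [fst u, snd u] \<in> M))"
| "image_term M (x # y # ys) =
     (let p = inv_into (preds S) \<iota> (x div 2); t = image_term M (y # ys) in
      if odd x then SOME u. Atom p [t, u] \<in> M else SOME u. Atom p [u, t] \<in> M)"

text \<open>Reversal puts the letter that created a null in front, so the recursion passes to the
  parent term.\<close>

definition chase_hom :: "('p, nat) inst \<Rightarrow> nat trm \<Rightarrow> nat trm" where
  "chase_hom M t = image_term M (rev (word t))"

lemma chase_hom_Const [simp]: "chase_hom M (Const c) = Const c"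
  by (simp add: chase_hom_def)

lemma chase_hom_root:
  assumes "p \<in> preds S"
  shows "chase_hom M (root p 0) = (SOME u. Atom p (replicate (arity S p) u) \<in> M)"
    and "chase_hom M (root p 1) = fst (SOME u. Atom p [fst u, snd u] \<in> M)"
    and "chase_hom M (root p 2) = snd (SOME u. Atom p [fst u, snd u] \<in> M)"
proof -
  have "Suc (3 * n) div 3 = n" "Suc (Suc (3 * n)) div 3 = n"
    "Suc (3 * n) mod 3 = Suc 0" "Suc (Suc (3 * n)) mod 3 = Suc (Suc 0)" for n :: nat
    by presburger+
  then show "chase_hom M (root p 0) = (SOME u. Atom p (replicate (arity S p) u) \<in> M)"
    and "chase_hom M (root p 1) = fst (SOME u. Atom p [fst u, snd u] \<in> M)"
    and "chase_hom M (root p 2) = snd (SOME u. Atom p [fst u, snd u] \<in> M)"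
    using assms inj by (simp_all add: chase_hom_def Let_def)
qed

lemma chase_hom_succ:
  assumes "p \<in> preds S" "word t \<noteq> []"
  shows "chase_hom M (succ t p True) = (SOME u. Atom p [chase_hom M t, u] \<in> M)"
    and "chase_hom M (succ t p False) = (SOME u. Atom p [u, chase_hom M t] \<in> M)"
proof -
  obtain y ys where "rev (word t) = y # ys" using assms(2) by (cases "rev (word t)") auto
  then show "chase_hom M (succ t p True) = (SOME u. Atom p [chase_hom M t, u] \<in> M)"
    and "chase_hom M (succ t p False) = (SOME u. Atom p [u, chase_hom M t] \<in> M)"
    using assms inj by (simp_all add: chase_hom_def Let_def)
qed

text \<open>Applying the rule in \<open>M\<close> yields some witness for the shape of the head.
  Only this shape is recorded in the name of a null, so one choice per name suits every rule and
  every match that creates it.\<close>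

lemma chase_into_model:
  assumes M: "is_model S D R M"
  shows "a \<in> chase \<Longrightarrow> apply_atom (chase_hom M) a \<in> M"
proof (induction rule: chase.induct)
  case (database a)
  have "map (chase_hom M) (args a) = args a"
  proof (rule map_idI)
    fix t assume "t \<in> set (args a)"
    then have "t \<in> range Const"
      using database db by (auto simp: is_database_def adom_def)
    then show "chase_hom M t = t" by auto
  qed
  then have "apply_atom (chase_hom M) a = a" by (cases a) simp
  moreover have "D \<subseteq> M" using M by (simp add: is_model_def)
  ultimately show ?case using database by (metis subsetD)
next
  case (verum a t)
  have "chase_hom M t \<in> set (args (apply_atom (chase_hom M) a))" using verum(2) by simp
  then have "chase_hom M t \<in> adom M" using verum.IH unfolding adom_def by blast
  then show ?case using M by (simp add: is_model_def is_instance_def)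
next
  case (rule r p vs h)
  let ?Y = "adom (body r)" and ?\<eta> = "chase_hom M"
  have p: "p \<in> preds S" "length vs = arity S p" and len: "length vs \<le> 2"
    using head_atom[OF rule(1,2)] by auto
  have wh: "word (h v) \<noteq> []" if v: "v \<in> ?Y" for v
  proof -
    obtain b where b: "b \<in> body r" "v \<in> set (args b)" using v by (auto simp: adom_def)
    then show ?thesis using word_nonempty[OF rule.hyps(3)[OF b(1)], of "h v"] by simp
  qed
  have "apply_atom (?\<eta> \<circ> h) b \<in> M" if "b \<in> body r" for b
    using rule.IH[OF that] by (cases b) simp
  moreover have "sat_rule M r" using M rule(1) by (simp add: is_model_def)
  ultimately obtain g where g: "\<And>v. v \<in> ?Y \<Longrightarrow> g v = (?\<eta> \<circ> h) v" and hd: "Atom p (map g vs) \<in> M"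
    using rule(2) sat_ruleE by metis
  from len show ?case
  proof (cases rule: list_le_2_cases)
    case 1
    then show ?thesis using hd by simp
  next
    case (2 x)
    show ?thesis
    proof (cases "x \<in> ?Y")
      case True
      then show ?thesis using hd g 2 by simp
    next
      case False
      have "Atom p [SOME u. Atom p [u] \<in> M] \<in> M" using hd 2 someI[of "\<lambda>u. Atom p [u] \<in> M" "g x"] by simp
      moreover have "arity S p = Suc 0" using p 2 by simp
      ultimately show ?thesis using False 2 p chase_hom_root(1)[of p M] by simp
    qed
  next
    case (3 x y)
    have hd: "Atom p [g x, g y] \<in> M" using hd 3 by simp
    have ar: "arity S p = Suc (Suc 0)" using p 3 by simp
    consider "x \<in> ?Y" "y \<in> ?Y" | "x \<in> ?Y" "y \<notin> ?Y" | "x \<notin> ?Y" "y \<in> ?Y"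
      | "x \<notin> ?Y" "y \<notin> ?Y" "x = y" | "x \<notin> ?Y" "y \<notin> ?Y" "x \<noteq> y" by blast
    then show ?thesis
    proof cases
      case 1
      then show ?thesis using hd g 3 by simp
    next
      case 2
      have "Atom p [?\<eta> (h x), SOME u. Atom p [?\<eta> (h x), u] \<in> M] \<in> M"
        using hd g 2 someI[of "\<lambda>u. Atom p [?\<eta> (h x), u] \<in> M" "g y"] by simp
      then show ?thesis using 2 3 p wh chase_hom_succ(1)[of p "h x" M] by simp
    next
      case c: 3
      have "Atom p [SOME u. Atom p [u, ?\<eta> (h y)] \<in> M, ?\<eta> (h y)] \<in> M"
        using hd g c someI[of "\<lambda>u. Atom p [u, ?\<eta> (h y)] \<in> M" "g x"] by simp
      then show ?thesis using c 3 p wh chase_hom_succ(2)[of p "h y" M] by simp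
    next
      case 4
      have "Atom p [SOME u. Atom p [u, u] \<in> M, SOME u. Atom p [u, u] \<in> M] \<in> M"
        using hd 4 someI[of "\<lambda>u. Atom p [u, u] \<in> M" "g x"] by simp
      then show ?thesis using 4 3 p ar chase_hom_root(1)[of p M] by simp
    next
      case 5
      \<comment> \<open>Both roots are components of one chosen pair; separate choices need not form
        an atom of \<open>M\<close>.\<close>
      let ?u = "SOME u. Atom p [fst u, snd u] \<in> M"
      have "Atom p [fst ?u, snd ?u] \<in> M"
        using hd someI[of "\<lambda>u. Atom p [fst u, snd u] \<in> M" "(g x, g y)"] by simp
      then show ?thesis using 5 3 p chase_hom_root(2,3)[of p M] by simp
    qed
  qed
qed

lemma chase_universal: "universal_model S D R chase"
  unfolding universal_model_def hom_def
  using chase_model chase_into_model by (auto intro!: exI[of _ "chase_hom _"])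

text \<open>\<open>q\<close> stands for the edge that enters the node \<open>q\<close>; cutting it
  separates the words that extend \<open>q\<close> from all others.\<close>

definition crosses :: "nat list \<Rightarrow> ('p, nat trm) atom \<Rightarrow> bool" where
  "crosses q a \<longleftrightarrow> (\<exists>s\<in>set (args a). \<exists>t\<in>set (args a). prefix q (word s) \<and> \<not> prefix q (word t))"

text \<open>On each branch of the forest, a treelike atom crosses at most one edge.\<close>

definition treelike :: "('p, nat trm) atom \<Rightarrow> bool" where
  "treelike a \<longleftrightarrow> (\<forall>w q q'. prefix q w \<longrightarrow> prefix q' w \<longrightarrow> crosses q a \<longrightarrow> crosses q' a \<longrightarrow> q = q')"

definition skeleton :: "('p, nat) inst" where
  "skeleton = {a \<in> chase. treelike a}"

text \<open>Between a parent and its child, only the edge into the child is crossed.\<close>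

lemma treelike_edge:
  assumes "set (args a) = {s, t}" "word t = word s @ [x]"
  shows "treelike a"
proof -
  have "q = word t" if "crosses q a" for q
    using that assms by (auto simp: crosses_def intro: prefix_order.trans)
  then show ?thesis by (auto simp: treelike_def)
qed

text \<open>An atom on two roots may cross two edges, but both have words of length one, and a
  branch has only one prefix of this length.\<close>

lemma treelike_roots:
  assumes "\<And>t. t \<in> set (args a) \<Longrightarrow> length (word t) = 1"
  shows "treelike a"
proof -
  have "length q = 1" if q: "crosses q a" for q
  proof -
    obtain s t where st: "s \<in> set (args a)" "prefix q (word s)" "\<not> prefix q (word t)"
      using q by (auto simp: crosses_def)
    then have "length q \<le> 1" "q \<noteq> []" using assms[of s] by (auto dest: prefix_length_le)
    then show ?thesis by (cases q) auto
  qed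
  then show ?thesis
    unfolding treelike_def by (metis prefix_length_prefix prefix_order.antisym order_refl)
qed

lemma treelike_one: "(\<And>s t. s \<in> set (args a) \<Longrightarrow> t \<in> set (args a) \<Longrightarrow> s = t) \<Longrightarrow> treelike a"
  by (auto simp: treelike_def crosses_def)

text \<open>
  Only rules without existential variables produce atoms outside the skeleton, and their effect
  follows already from finitely many skeleton atoms.
\<close>

lemma chase_from_skeleton:
  "a \<in> chase \<Longrightarrow> \<exists>F. finite F \<and> F \<subseteq> skeleton \<and> (\<forall>M. is_model S F R M \<longrightarrow> a \<in> M)"
proof (induction rule: chase.induct)
  case (database a)
  have "treelike a"
  proof (rule treelike_roots)
    fix t assume "t \<in> set (args a)"
    then have "t \<in> range Const"
      using database db by (auto simp: is_database_def adom_def)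
    then show "length (word t) = 1" by auto
  qed
  then show ?case using database
    by (intro exI[of _ "{a}"]) (auto simp: skeleton_def is_model_def intro: chase.database)
next
  case (verum a t)
  then obtain F where F: "finite F" "F \<subseteq> skeleton" "\<forall>M. is_model S F R M \<longrightarrow> a \<in> M" by blast
  have "Atom (verum S) [t] \<in> M" if M: "is_model S F R M" for M
  proof -
    have "t \<in> adom M" using F(3) M verum(2) by (auto simp: adom_def)
    then show ?thesis using M by (auto simp: is_model_def is_instance_def)
  qed
  then show ?case using F by blast
next
  case (rule r p vs h)
  let ?Y = "adom (body r)"
  let ?a = "Atom p (map (skolem ?Y p vs h) vs)"
  show ?case
  proof (cases "set vs \<subseteq> ?Y")
    case True
    \<comment> \<open>The head has no existential variable, so its instance is forced in every model
      of the union of the sets chosen for the body atoms.\<close>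
    obtain F where F: "\<And>b. b \<in> body r \<Longrightarrow>
        finite (F b) \<and> F b \<subseteq> skeleton \<and> (\<forall>M. is_model S (F b) R M \<longrightarrow> apply_atom h b \<in> M)"
      using rule.IH by metis
    have "?a \<in> M" if M: "is_model S (\<Union>b\<in>body r. F b) R M" for M
    proof -
      have "apply_atom h b \<in> M" if "b \<in> body r" for b
      proof -
        have "is_model S (F b) R M" using M that unfolding is_model_def by blast
        then show ?thesis using F[OF that] by blast
      qed
      moreover have "sat_rule M r" using M rule(1) by (simp add: is_model_def)
      ultimately obtain g where g: "\<And>v. v \<in> ?Y \<Longrightarrow> g v = h v" and "Atom p (map g vs) \<in> M"
        using rule(2) sat_ruleE by metis
      moreover have "map g vs = map (skolem ?Y p vs h) vs"
        using True g by (auto simp: skolem_frontier)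
      ultimately show ?thesis by metis
    qed
    moreover have "finite (body r)" using rules[OF rule(1)] by (simp add: is_rule_def)
    ultimately show ?thesis using F by (intro exI[of _ "\<Union>b\<in>body r. F b"]) auto
  next
    case False
    have len: "length vs \<le> 2" using head_atom[OF rule(1,2)] by auto
    \<comment> \<open>With an existential variable, the arguments are a parent and its child, roots,
      or a single term; the atom then belongs to the skeleton itself.\<close>
    then have "treelike ?a"
    proof (cases rule: list_le_2_cases)
      case (3 x y)
      then consider "x \<in> ?Y" "y \<notin> ?Y" | "x \<notin> ?Y" "y \<in> ?Y" | "x \<notin> ?Y" "y \<notin> ?Y" using False by auto
      then show ?thesis
      proof cases
        case 1
        then show ?thesis using 3 by (intro treelike_edge[of _ "h x" "succ (h x) p True"]) auto
      next
        case 2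
        then show ?thesis using 3 by (intro treelike_edge[of _ "h y" "succ (h y) p False"]) auto
      next
        case c: 3
        then show ?thesis using 3 by (intro treelike_roots) auto
      qed
    qed (auto intro: treelike_one)
    moreover have "?a \<in> chase" using rule by (intro chase.rule) auto
    ultimately show ?thesis
      by (intro exI[of _ "{?a}"]) (auto simp: skeleton_def is_model_def)
  qed
qed

end

section \<open>Matches of rewritings over the skeleton\<close>

text \<open>The terminator \<open>False\<close> that is appended to \<open>unary_code w\<close> below makes the code prefix-free.\<close>

fun unary_code :: "nat list \<Rightarrow> bool list" where
  "unary_code [] = []"
| "unary_code (x # xs) = replicate (Suc x) True @ False # unary_code xs"

lemma code_append: "unary_code (xs @ ys) = unary_code xs @ unary_code ys"
  by (induction xs) auto

lemma unary_prefix: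
  "prefix (replicate (Suc x) True @ False # xs) (replicate (Suc y) True @ False # ys) \<longleftrightarrow>
     x = y \<and> prefix xs ys"
proof (induction x arbitrary: y)
  case 0
  then show ?case by (cases y) auto
next
  case (Suc x)
  note IH = Suc.IH
  show ?case
  proof (cases y)
    case (Suc y')
    then show ?thesis using IH[of y'] by simp
  qed simp
qed

lemma code_prefix_free: "prefix (unary_code w @ [False]) (unary_code w' @ [False]) \<Longrightarrow> w = w'"
proof (induction w arbitrary: w')
  case Nil
  then show ?case by (cases w') auto
next
  case (Cons x w)
  show ?case
  proof (cases w')
    case (Cons y w'')
    then show ?thesis using Cons.prems Cons.IH[of w''] unary_prefix[of x "unary_code w @ [False]" y "unary_code w'' @ [False]"]
      by simp
  qed (use Cons.prems in simp)
qed

text \<open>A letter \<open>x\<close> costs \<open>x + 2\<close> bits, its closing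
  \<open>False\<close> included.\<close>

lemma length_code: "(\<And>x. x \<in> set w \<Longrightarrow> x \<le> n) \<Longrightarrow> length (unary_code w) \<le> (n + 2) * length w"
  by (induction w) force+

text \<open>Dropping at most \<open>k\<close> letters from the end of \<open>w\<close> removes at
  most \<open>(n + 2) * k\<close> bits of its code, fewer than \<open>length u\<close>. The rest
  still contains the bit in which the two codes differ, so it is no prefix of \<open>w'\<close>.
  This gives \<open>k + 1\<close> candidate edges for a cut.\<close>

lemma many_prefixes:
  assumes letters: "\<And>x. x \<in> set w \<Longrightarrow> x \<le> n"
    and w: "unary_code w @ [False] = s @ b # u" and w': "unary_code w' @ [False] = s @ b' # v" and "b \<noteq> b'"
    and u: "length u \<ge> (n + 2) * (k + 1)"
  obtains Q where "finite Q" "card Q = Suc k" "\<And>q. q \<in> Q \<Longrightarrow> prefix q w \<and> \<not> prefix q w'"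
proof -
  define Q where "Q = (\<lambda>j. take (length w - j) w) ` {..k}"
  have len: "Suc (length (unary_code w)) = Suc (length s + length u)"
    using arg_cong[OF w, of length] by simp
  have "length (unary_code w) \<le> (n + 2) * length w" using length_code letters by blast
  then have "(n + 2) * (k + 1) \<le> (n + 2) * length w" using len u by linarith
  then have "k + 1 \<le> length w" unfolding mult_le_cancel1 by simp
  then have k: "k < length w" by simp
  have np: "\<not> prefix (take (length w - j) w) w'" if "j \<le> k" for j
  proof
    let ?q = "take (length w - j) w" and ?d = "drop (length w - j) w"
    assume "prefix ?q w'"
    then obtain z where z: "w' = ?q @ z" by (elim prefixE)
    have "length ?d \<le> k" using that k by simp
    have "length (unary_code ?d) \<le> (n + 2) * length ?d"
      by (rule length_code) (use letters in \<open>auto dest: in_set_dropD\<close>)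
    also have "\<dots> \<le> (n + 2) * k" using \<open>length ?d \<le> k\<close> by (rule mult_le_mono2)
    finally have "length (unary_code ?d) < length u" using u by simp
    moreover have cw: "unary_code w = unary_code ?q @ unary_code ?d" by (simp flip: code_append)
    ultimately have "length s < length (unary_code ?q)" using len by simp
    moreover have "(unary_code w @ [False]) ! length s = b" "(unary_code w' @ [False]) ! length s = b'"
      using w w' by simp_all
    ultimately show False using cw z \<open>b \<noteq> b'\<close> by (simp add: code_append nth_append)
  qed
  have "inj_on (\<lambda>j. take (length w - j) w) {..k}"
  proof (rule inj_onI)
    fix i j assume "i \<in> {..k}" "j \<in> {..k}" "take (length w - i) w = take (length w - j) w"
    then have "length w - i = length w - j" by (metis diff_le_self length_take min.absorb2)
    then show "i = j" using k \<open>i \<in> {..k}\<close> \<open>j \<in> {..k}\<close> by auto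
  qed
  then have "card Q = Suc k" by (simp add: Q_def card_image)
  moreover have "finite Q" by (simp add: Q_def)
  moreover have "prefix q w \<and> \<not> prefix q w'" if "q \<in> Q" for q
    using that np by (auto simp: Q_def take_is_prefix)
  ultimately show ?thesis using that by blast
qed

section \<open>Cutting the forest and exchanging matches\<close>

context binary_rules
begin

text \<open>Pigeonhole: all of \<open>Q\<close> lies on the branch of \<open>w\<close>, so a
  treelike atom crosses at most one member of \<open>Q\<close>.\<close>

lemma uncrossed_prefix:
  assumes "finite A" "A \<subseteq> skeleton" "finite Q" "card A < card Q" "\<And>q. q \<in> Q \<Longrightarrow> prefix q w"
  shows "\<exists>q\<in>Q. \<forall>a\<in>A. \<not> crosses q a"
proof (cases "\<forall>q\<in>Q. \<exists>a\<in>A. crosses q a")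
  case True
  then obtain g where g: "\<And>q. q \<in> Q \<Longrightarrow> g q \<in> A \<and> crosses q (g q)" by metis
  have "inj_on g Q"
  proof (rule inj_onI)
    fix q q' assume q: "q \<in> Q" "q' \<in> Q" "g q = g q'"
    then have "treelike (g q)" using g assms(2) by (auto simp: skeleton_def)
    moreover have "crosses q (g q)" "crosses q' (g q)" using g[OF q(1)] g[OF q(2)] q(3) by metis+
    ultimately show "q = q'" using assms(5)[OF q(1)] assms(5)[OF q(2)] unfolding treelike_def by blast
  qed
  then have "card Q \<le> card A" using g assms(1) by (intro card_inj_on_le[of g]) auto
  then show ?thesis using assms(4) by simp
qed blast

text \<open>A rewriting has to be correct on instances only, while the image of a match may lack the
  \<open>verum\<close> atoms of its terms.\<close>

definition verum_closure :: "('p, nat) inst \<Rightarrow> ('p, nat) inst" where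
  "verum_closure F = F \<union> (\<lambda>t. Atom (verum S) [t]) ` adom F"

lemma verum_closure:
  assumes "finite F" "F \<subseteq> skeleton"
  shows "finite (verum_closure F)" "verum_closure F \<subseteq> skeleton" "is_instance S (verum_closure F)"
    "adom (verum_closure F) = adom F"
proof -
  have ad: "adom F \<subseteq> adom chase" using assms(2) by (auto simp: skeleton_def adom_def)
  show "finite (verum_closure F)" using assms(1) by (simp add: verum_closure_def adom_def)
  have "Atom (verum S) [t] \<in> skeleton" if t: "t \<in> adom F" for t
    using ad t by (auto simp: skeleton_def adom_def intro: chase.verum treelike_one)
  then show sub: "verum_closure F \<subseteq> skeleton" using assms(2) by (auto simp: verum_closure_def)
  show eq: "adom (verum_closure F) = adom F" by (auto simp: verum_closure_def adom_def)
  have "is_atom S a" if "a \<in> verum_closure F" for a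
    using sub that is_atom_chase by (auto simp: skeleton_def)
  then show "is_instance S (verum_closure F)"
    by (simp add: is_instance_def eq) (simp add: verum_closure_def)
qed

text \<open>Rewritings speak about finite instances, but the skeleton may be infinite. One direction
  takes a finite part of it that entails the atom; in the other, the image of a match is the finite
  part, and the chase is a model of it.\<close>

lemma chase_iff_rewriting:
  assumes rw: "is_rewriting S R (CQ [0..<arity S p] {Atom p [0..<arity S p]}) Q"
    and len: "length ts = arity S p"
  shows "Atom p ts \<in> chase \<longleftrightarrow> (\<exists>q\<in>Q. sat_cq skeleton q ts)"
proof
  let ?q = "CQ [0..<arity S p] {Atom p [0..<arity S p]}"
  have sat: "sat_cq M ?q ts \<longleftrightarrow> Atom p ts \<in> M" for M
  proof -
    have "map ((!) ts) [0..<arity S p] = ts" using len by (metis map_nth)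
    then show ?thesis by (auto simp: sat_cq_def intro!: exI[of _ "(!) ts"])
  qed
  have rw: "entails S F R ?q ts \<longleftrightarrow> (\<exists>q\<in>Q. sat_cq F q ts)"
    if "is_instance S F" "finite F" "set ts \<subseteq> adom F" for F
    using rw len that by (simp add: is_rewriting_def)
  {
    assume a: "Atom p ts \<in> chase"
    then obtain F where F: "finite F" "F \<subseteq> skeleton" "\<forall>M. is_model S F R M \<longrightarrow> Atom p ts \<in> M"
      using chase_from_skeleton by blast
    \<comment> \<open>The added atoms make \<open>ts\<close> a tuple of terms of the instance, as
      the definition of a rewriting demands.\<close>
    define F' where "F' = F \<union> (\<lambda>t. Atom (verum S) [t]) ` set ts"
    have F': "finite F'" "F' \<subseteq> skeleton"
      using F a by (auto simp: F'_def skeleton_def intro: chase.verum treelike_one)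
    have "entails S (verum_closure F') R ?q ts"
      unfolding entails_def sat using F(3) by (auto simp: F'_def verum_closure_def is_model_def)
    moreover have "set ts \<subseteq> adom (verum_closure F')"
      unfolding verum_closure(4)[OF F'] by (auto simp: F'_def adom_def)
    ultimately obtain q where "q \<in> Q" "sat_cq (verum_closure F') q ts"
      using rw verum_closure[OF F'] by blast
    then show "\<exists>q\<in>Q. sat_cq skeleton q ts"
      using verum_closure(2)[OF F'] unfolding sat_cq_def by blast
  next
    assume "\<exists>q\<in>Q. sat_cq skeleton q ts"
    then obtain q h where q: "q \<in> Q" "map h (free q) = ts" "apply_atom h ` atoms q \<subseteq> skeleton"
      unfolding sat_cq_def by blast
    have cq: "is_cq S q" using assms(1) q(1) by (simp add: is_rewriting_def)
    define F where "F = apply_atom h ` atoms q"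
    have F: "finite F" "F \<subseteq> skeleton" using cq q by (simp_all add: F_def is_cq_def)
    have "set ts \<subseteq> adom F"
      using cq q(2) by (fastforce simp: is_cq_def F_def adom_def)
    moreover have "sat_cq (verum_closure F) q ts"
      using q(2) unfolding sat_cq_def F_def verum_closure_def by blast
    ultimately have "entails S (verum_closure F) R ?q ts"
      using rw verum_closure[OF F] q(1) by metis
    moreover have "is_model S (verum_closure F) R chase"
      using chase_model verum_closure(2)[OF F] by (auto simp: is_model_def skeleton_def)
    ultimately show "Atom p ts \<in> chase" using sat by (simp add: entails_def)
  }
qed

text \<open>A unary type over the skeleton. It ranges over subsets \<open>W\<close> of the atoms
  because a cut leaves only a part of the query on either side.\<close>

definition query_type :: "'p cq set \<Rightarrow> nat trm \<Rightarrow> ('p cq \<times> nat \<times> ('p, nat) atom set) set" where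
  "query_type Q e = {(q, z, W). q \<in> Q \<and> z \<in> set (free q) \<and> W \<subseteq> atoms q \<and>
     (\<exists>g. apply_atom g ` W \<subseteq> skeleton \<and> g z = e)}"

lemma finite_query_types:
  assumes "finite Q" "\<And>q. q \<in> Q \<Longrightarrow> finite (atoms q)"
  shows "finite (query_type Q ` E)"
proof (rule finite_subset)
  let ?B = "\<Union>q\<in>Q. {q} \<times> set (free q) \<times> Pow (atoms q)"
  show "query_type Q ` E \<subseteq> Pow ?B" by (auto simp: query_type_def)
  show "finite (Pow ?B)" using assms by simp
qed

text \<open>
  No atom of the match crosses \<open>P\<close>, so the query falls apart into two parts without common
  variables, one containing \<open>x\<close> and the other \<open>y\<close>, which can be matched independently.
\<close>

lemma split_match:
  assumes h: "apply_atom h ` atoms q \<subseteq> skeleton" and q: "q \<in> Q" "free q = [x, y]"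
    and P: "P (h x)" "\<not> P (h y)"
    and uncrossed: "\<And>a. a \<in> atoms q \<Longrightarrow>
      (\<forall>v\<in>set (args a). P (h v)) \<or> (\<forall>v\<in>set (args a). \<not> P (h v))"
    and f: "query_type Q f = query_type Q (h x)" and f': "query_type Q f' = query_type Q (h y)"
  shows "sat_cq skeleton q [f, f']"
proof -
  define W where "W = {a \<in> atoms q. \<forall>v\<in>set (args a). P (h v)}"
  have match: "\<exists>g. apply_atom g ` V \<subseteq> skeleton \<and> g z = t"
    if "z \<in> set (free q)" "V \<subseteq> atoms q" "query_type Q t = query_type Q (h z)" for z V t
  proof -
    have "apply_atom h ` V \<subseteq> skeleton" using h that(2) by blast
    then have "(q, z, V) \<in> query_type Q (h z)" using q(1) that(1,2) unfolding query_type_def by blast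
    then have "(q, z, V) \<in> query_type Q t" using that(3) by simp
    then show ?thesis by (simp add: query_type_def)
  qed
  have "W \<subseteq> atoms q" unfolding W_def by (rule Collect_restrict)
  then obtain g where g: "apply_atom g ` W \<subseteq> skeleton" "g x = f"
    using match[of x W f] f q(2) by (metis list.set_intros(1))
  obtain g' where g': "apply_atom g' ` (atoms q - W) \<subseteq> skeleton" "g' y = f'"
    using match[of y "atoms q - W" f'] f' q(2) by (metis Diff_subset list.set_intros)
  \<comment> \<open>The two matches are glued along \<open>P\<close>; the old match \<open>h\<close>
    only tells on which side a variable lies.\<close>
  define k where "k v = (if P (h v) then g v else g' v)" for v
  have "apply_atom k a \<in> skeleton" if a: "a \<in> atoms q" for a
  proof (cases "a \<in> W")
    case True
    then have "map k (args a) = map g (args a)" by (simp add: W_def k_def)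
    then have "apply_atom k a = apply_atom g a" by (cases a) simp
    moreover have "apply_atom g a \<in> skeleton" using g(1) True by blast
    ultimately show ?thesis by simp
  next
    case False
    then have "\<not> (\<forall>v\<in>set (args a). P (h v))" using a by (simp add: W_def)
    then have "\<forall>v\<in>set (args a). \<not> P (h v)" using uncrossed[OF a] by blast
    then have "map k (args a) = map g' (args a)" by (simp add: k_def)
    then have "apply_atom k a = apply_atom g' a" by (cases a) simp
    moreover have "apply_atom g' a \<in> skeleton" using g'(1) False a by blast
    ultimately show ?thesis by simp
  qed
  then have "apply_atom k ` atoms q \<subseteq> skeleton" by (rule image_subsetI)
  moreover have "map k (free q) = [f, f']" using q(2) g(2) g'(2) P by (simp add: k_def)
  ultimately show ?thesis unfolding sat_cq_def by (intro exI conjI)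
qed

text \<open>A match has at most \<open>k\<close> atoms, while at least \<open>k + 1\<close> edges on
  the branch of the far term separate it from the other term. Some such edge is uncrossed, and
  \<open>split_match\<close> applies there.\<close>

lemma far_atom:
  assumes rw: "is_rewriting S R (CQ [0..<arity S p] {Atom p [0..<arity S p]}) Q"
    and Q: "Q \<subseteq> QQ" and k: "\<forall>q\<in>Q. card (atoms q) \<le> k"
    and a: "Atom p [e, e'] \<in> chase" and letters: "\<forall>t\<in>adom chase. \<forall>x\<in>set (word t). x \<le> n"
    and e: "unary_code (word e) @ [False] = s @ b # u" "unary_code (word e') @ [False] = s @ b' # v" "b \<noteq> b'"
    and far: "length u \<ge> (n + 2) * (k + 1) \<or> length v \<ge> (n + 2) * (k + 1)"
    and f: "query_type QQ f = query_type QQ e" "query_type QQ f' = query_type QQ e'"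
  shows "Atom p [f, f'] \<in> chase"
proof -
  have len: "length [e, e'] = arity S p" "length [f, f'] = arity S p"
    using is_atom_chase[OF a] by (simp_all add: is_atom_def)
  have ad: "e \<in> adom chase" "e' \<in> adom chase" using a by (force simp: adom_def)+
  have "\<exists>q\<in>Q. sat_cq skeleton q [e, e']" using a chase_iff_rewriting[OF rw len(1)] by simp
  then obtain q h where q: "q \<in> Q" "map h (free q) = [e, e']" "apply_atom h ` atoms q \<subseteq> skeleton"
    unfolding sat_cq_def by (elim bexE exE conjE)
  obtain x y where xy: "free q = [x, y]" "h x = e" "h y = e'" using q(2) by auto
  have fin: "finite (atoms q)" using rw q(1) by (auto simp: is_rewriting_def is_cq_def)
  have cut: "\<exists>r. prefix r (word t) \<and> \<not> prefix r (word t') \<and> (\<forall>a\<in>atoms q. \<not> crosses r (apply_atom h a))"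
    if w: "t \<in> adom chase" "unary_code (word t) @ [False] = s @ c # w"
      "unary_code (word t') @ [False] = s @ c' # w'" "c \<noteq> c'" "length w \<ge> (n + 2) * (k + 1)"
    for t t' c c' w w'
  proof -
    have "\<And>x. x \<in> set (word t) \<Longrightarrow> x \<le> n" using letters w(1) by blast
    from many_prefixes[OF this w(2-5)] obtain B where B: "finite B" "card B = Suc k"
      "\<And>r. r \<in> B \<Longrightarrow> prefix r (word t) \<and> \<not> prefix r (word t')"
      by blast
    have lt: "card (apply_atom h ` atoms q) < card B"
    proof -
      have "card (apply_atom h ` atoms q) \<le> card (atoms q)" using fin by (rule card_image_le)
      also have "\<dots> \<le> k" using k q(1) by blast
      finally show ?thesis using B(2) by simp
    qed
    show ?thesis
      using uncrossed_prefix[OF finite_imageI[OF fin] q(3) B(1) lt conjunct1[OF B(3)]] B(3) by blast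
  qed
  \<comment> \<open>The cut lies on the branch of a term that is far; if \<open>e'\<close> is used,
    the predicate is negated so that it holds of \<open>e\<close>.\<close>
  obtain P where P: "P e" "\<not> P e'" "\<forall>a\<in>atoms q. (\<forall>v\<in>set (args a). P (h v)) \<or> (\<forall>v\<in>set (args a). \<not> P (h v))"
  proof (cases "length u \<ge> (n + 2) * (k + 1)")
    case True
    then obtain r where r: "prefix r (word e)" "\<not> prefix r (word e')"
      "\<forall>a\<in>atoms q. \<not> crosses r (apply_atom h a)"
      using cut[OF ad(1) e] by blast
    then show ?thesis using that[of "\<lambda>t. prefix r (word t)"] by (auto simp: crosses_def)
  next
    case False
    then obtain r where r: "prefix r (word e')" "\<not> prefix r (word e)"
      "\<forall>a\<in>atoms q. \<not> crosses r (apply_atom h a)"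
      using cut[OF ad(2) e(2,1) e(3)[symmetric]] far by blast
    then show ?thesis using that[of "\<lambda>t. \<not> prefix r (word t)"] by (auto simp: crosses_def)
  qed
  have "sat_cq skeleton q [f, f']"
  proof (rule split_match[OF q(3) _ xy(1)])
    show "q \<in> QQ" using q(1) Q by blast
    show "P (h x)" "\<not> P (h y)" using P xy by simp_all
    show "query_type QQ f = query_type QQ (h x)" "query_type QQ f' = query_type QQ (h y)"
      using f xy by simp_all
  qed (use P(3) in blast)
  then have "\<exists>q\<in>Q. sat_cq skeleton q [f, f']" using q(1) by (rule bexI)
  then show ?thesis using chase_iff_rewriting[OF rw len(2)] by simp
qed

lemma cliquewidth_chase:
  assumes "fus S R"
  shows "cliquewidth S chase < \<infinity>"
proof -
  have "\<exists>Q. is_rewriting S R (CQ [0..<arity S p] {Atom p [0..<arity S p]}) Q" if "p \<in> preds S" for p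
  proof -
    have "is_cq S (CQ [0..<arity S p] {Atom p [0..<arity S p]})"
      using that by (simp add: is_cq_def is_atom_def adom_def)
    then show ?thesis using assms by (simp add: fus_def)
  qed
  then obtain Q where Q: "\<And>p. p \<in> preds S \<Longrightarrow>
      is_rewriting S R (CQ [0..<arity S p] {Atom p [0..<arity S p]}) (Q p)"
    by metis
  \<comment> \<open>The union over all predicates lets a single type serve for the atoms of every
    predicate.\<close>
  define QQ where "QQ = (\<Union>p\<in>preds S. Q p)"
  have fin: "finite (preds S)" using sig by (simp add: is_sig_def)
  then have fin_QQ: "finite QQ" using Q by (auto simp: QQ_def is_rewriting_def)
  have fin_atoms: "finite (atoms q)" if "q \<in> QQ" for q
    using that Q by (auto simp: QQ_def is_rewriting_def is_cq_def)
  \<comment> \<open>The inserted \<open>0\<close> makes the maximum defined without an argument that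
    \<open>QQ\<close> is nonempty.\<close>
  define k where "k = Max (insert 0 ((\<lambda>q. card (atoms q)) ` QQ))"
  have k: "card (atoms q) \<le> k" if "q \<in> QQ" for q
    unfolding k_def using fin_QQ that by (intro Max_ge) auto
  obtain n where n: "\<forall>t\<in>adom chase. \<forall>x\<in>set (word t). x \<le> n"
    using finite_letters by blast
  have inst: "is_instance S chase" using chase_model by (simp add: is_model_def)
  show ?thesis
  proof (rule cliquewidth_finite_if_far_determined[where addr = "\<lambda>t. unary_code (word t) @ [False]"
        and c = "query_type QQ" and m = "(n + 2) * (k + 1)"])
    fix t t' assume "t \<in> adom chase" "t' \<in> adom chase"
      "prefix (unary_code (word t) @ [False]) (unary_code (word t') @ [False])"
    then show "t = t'" using code_prefix_free inj_word by (metis inj_onD)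
  next
    fix p e e' s b b' u v f f'
    assume *: "Atom p [e, e'] \<in> chase" "unary_code (word e) @ [False] = s @ b # u"
      "unary_code (word e') @ [False] = s @ b' # v" "b \<noteq> b'"
      "(n + 2) * (k + 1) \<le> length u \<or> (n + 2) * (k + 1) \<le> length v"
      "query_type QQ f = query_type QQ e" "query_type QQ f' = query_type QQ e'"
    have p: "p \<in> preds S" using is_atom_chase[OF *(1)] by (simp add: is_atom_def)
    then have sub: "Q p \<subseteq> QQ" unfolding QQ_def by (rule UN_upper)
    then have "\<forall>q\<in>Q p. card (atoms q) \<le> k" using k by blast
    from far_atom[OF Q[OF p] sub this *(1) n *(2-7)]
    show "Atom p [f, f'] \<in> chase" .
  next
    show "finite (query_type QQ ` adom chase)" using fin_QQ fin_atoms by (rule finite_query_types)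
  qed (fact fin binary inst finite_consts)+
qed

end

theorem theorem20:
  fixes S :: "'p sig" and R :: "'p rule set"
  assumes "is_sig S" and "at_most_binary S"
    and "\<forall>r\<in>R. is_rule S r" and "\<forall>r\<in>R. single_headed r"
    and "fus S R"
  shows "fcs S R"
  unfolding fcs_def
proof (intro allI impI)
  fix D assume D: "is_database S D"
  have "finite (preds S)" using assms(1) by (simp add: is_sig_def)
  from finite_imp_inj_to_nat_seg[OF this]
  obtain \<iota> :: "'p \<Rightarrow> nat" where "inj_on \<iota> (preds S)" by (elim exE conjE)
  then interpret binary_rules S R D \<iota>
    using assms D by unfold_locales blast+
  show "\<exists>U. universal_model S D R U \<and> cliquewidth S U < \<infinity>"
    using chase_universal cliquewidth_chase[OF assms(5)] by (intro exI conjI)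
qed

end
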